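(* Let $X$ be a Hilbert space, $(\mathcal P,d_1)$ and $(\mathcal Q,d_2)$ metric spaces, $f\colon X\times\mathcal P\times\mathcal Q\to X$ a mapping, $g\colon X\times\mathcal P\to\overline{\mathbb R}$ a lower semicontinuous function, and let $\bar x\in S(\bar v,\bar p,\bar q)$, where $$S(v,p,q)=\{x\in X\mid v\in f(x,p,q)+\partial_xg(x,p)\}.$$ Put $\hat v:=\bar v-f(\bar x,\bar p,\bar q)$, assume that (A1)--(A3) (see context) are satisfied, and let $\mathcal R$ be the threshold of prox-regularity of $g$ at $(\bar x,\bar p)$ for $\hat v$. Assume in addition that $f$ is locally strongly monotone in $x$ on some neighborhood $U\times P\times Q$ of $(\bar x,\bar p,\bar q)$ with modulus $\sigma>\mathcal R$, i.e. $$\langle f(x_1,p,q)-f(x_2,p,q),x_1-x_2\rangle\ge\sigma\|x_1-x_2\|^2\quad\text{for all }x_1,x_2\in U,\ (p,q)\in P\times Q.$$ Then $\bar x$ is a Hölderian fully stable solution of $v\in f(x,p,q)+\partial_xg(x,p)$ corresponding to $(\bar v,\bar p,\bar q)$.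
   Context: Notation. $X$ is a real Hilbert space identified with its dual, $\overline{\mathbb R}=(-\infty,\infty]$, $\mathbb B$ is a closed unit ball. Generalized differentiation. For $\varphi\colon X\to\overline{\mathbb R}$ and $\varphi(\bar x)<\infty$, $\hat\partial\varphi(\bar x)=\{v\mid\liminf_{x\to\bar x}\frac{\varphi(x)-\varphi(\bar x)-\langle v,x-\bar x\rangle}{\|x-\bar x\|}\ge0\}$; the limiting subdifferential $\partial\varphi(\bar x)$ is the set of all $v$ for which there are $x_k\to\bar x$ with $\varphi(x_k)\to\varphi(\bar x)$ and $v_k\in\hat\partial\varphi(x_k)$ with $v_k\to v$ weakly. $\partial_xg(x,p)$ is the limiting subdifferential of $g(\cdot,p)$ at $x$, and $\operatorname{gph}\partial_xg=\{(x,p,v)\mid v\in\partial_xg(x,p)\}$. Lipschitz-like. A set-valued mapping $F$ from a metric space $(M,d)$ to a normed space is Lipschitz-like around $(\bar m,\bar y)\in\operatorname{gph}F$ if there are $\ell>0$ and neighborhoods $U$ of $\bar m$, $V$ of $\bar y$ with $F(m)\cap V\subset F(m')+\ell d(m,m')\mathbb B$ for all $m,m'\in U$. Assumptions. (A1) There are $L>0$ and a neighborhood $U\times P\times Q$ of $(\bar x,\bar p,\bar q)$ on which $\|f(x_1,p_1,q_1)-f(x_2,p_2,q_2)\|\le L[\|x_1-x_2\|+d_1(p_1,p_2)+d_2(q_1,q_2)]$. (A2) $g$ is parametrically continuously prox-regular at $(\bar x,\bar p)$ for $\hat v$, i.e. (a) there are neighborhoods $U$ of $\bar x$, $V$ of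 $\hat v$, $P$ of $\bar p$ and $\varepsilon,r>0$ with $g(x,p)\ge g(u,p)+\langle v,x-u\rangle-\frac r2\|x-u\|^2$ for all $x\in U$ whenever $v\in\partial_xg(u,p)\cap V$, $u\in U$, $p\in P$, $g(u,p)\le g(\bar x,\bar p)+\varepsilon$; and (b) $(x,p,v)\mapsto g(x,p)$ is continuous relative to $\operatorname{gph}\partial_xg$ at $(\bar x,\bar p,\hat v)$. The infimum of all $r>0$ for which (a) holds (with some $U,V,P,\varepsilon$) is the threshold of prox-regularity $\mathcal R$ of $g$ at $(\bar x,\bar p)$ for $\hat v$. (A3) The mapping $p\mapsto\operatorname{epi}g(\cdot,p)$ is Lipschitz-like around $(\bar p,(\bar x,g(\bar x,\bar p)))$. Full stability. A single-valued localization of a set-valued mapping $F$ relative to a neighborhood $A\times B$ of a point of $\operatorname{gph}F$ is a single-valued mapping $\vartheta\colon A\to B$, defined on all of $A$, with $\operatorname{gph}\vartheta=\operatorname{gph}F\cap(A\times B)$. $\bar x$ is Hölderian fully stable corresponding to $(\bar v,\bar p,\bar q)$ if $S$ has a single-valued localization $\vartheta$ relative to some neighborhood $V\times P\times Q\times U$ of $(\bar v,\bar p,\bar q,\bar x)$ and there are $\kappa,\ell>0$ such that for all $(v_i,p_i,q_i)\in V\times P\times Q$, $i=1,2$, $$\|(v_1-v_2)-2\kappa[\vartheta(v_1,p_1,q_1)-\vartheta(v_2,p_2,q_2)]\|\le\|v_1-v_2\|+\ell[d_1(p_1,p_2)^{1/2}+d_2(q_1,q_2)].$$ *)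

theory Defs
  imports "HOL-Analysis.Analysis"
begin

text \<open>
  Conventions.  The extended reals \<open>(-\<infinity>, \<infinity>]\<close> of variational analysis are modelled by type
  \<^typ>\<open>ereal\<close>; that the value \<open>-\<infinity>\<close> is not taken is a hypothesis where it is needed.
  A neighborhood of a point is a (not necessarily open) set with the point in its interior.
  Set-valued mappings are functions into sets.
\<close>

definition lower_semicontinuous :: "('a::topological_space \<Rightarrow> ereal) \<Rightarrow> bool" where
  "lower_semicontinuous \<phi> \<longleftrightarrow> (\<forall>z. \<phi> z \<le> Liminf (at z) \<phi>)"

definition gph :: "('m \<Rightarrow> 'y set) \<Rightarrow> ('m \<times> 'y) set" where
  "gph F = {(m, y). y \<in> F m}"

text \<open>The library's \<^const>\<open>epigraph\<close> is for real-valued functions only.\<close>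

definition epi :: "('a \<Rightarrow> ereal) \<Rightarrow> ('a \<times> real) set" where
  "epi \<phi> = {(x, t). \<phi> x \<le> ereal t}"

text \<open>Both subdifferentials are empty at points where the function is not finite.\<close>

definition regular_subdiff :: "('x::real_inner \<Rightarrow> ereal) \<Rightarrow> 'x \<Rightarrow> 'x set" where
  "regular_subdiff \<phi> x =
     {v. \<bar>\<phi> x\<bar> \<noteq> \<infinity> \<and>
         0 \<le> Liminf (at x) (\<lambda>y. (\<phi> y - \<phi> x - ereal (v \<bullet> (y - x))) / ereal (norm (y - x)))}"

definition weakly_converges :: "(nat \<Rightarrow> 'x::real_inner) \<Rightarrow> 'x \<Rightarrow> bool" where
  "weakly_converges V v \<longleftrightarrow> (\<forall>w. (\<lambda>k. V k \<bullet> w) \<longlonglongrightarrow> v \<bullet> w)"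

definition limiting_subdiff :: "('x::real_inner \<Rightarrow> ereal) \<Rightarrow> 'x \<Rightarrow> 'x set" where
  "limiting_subdiff \<phi> x =
     {v. \<bar>\<phi> x\<bar> \<noteq> \<infinity> \<and>
         (\<exists>X V. X \<longlonglongrightarrow> x \<and> (\<lambda>k. \<phi> (X k)) \<longlonglongrightarrow> \<phi> x \<and>
                (\<forall>k. V k \<in> regular_subdiff \<phi> (X k)) \<and> weakly_converges V v)}"

definition partial_subdiff ::
    "('x::real_inner \<Rightarrow> 'p \<Rightarrow> ereal) \<Rightarrow> 'x \<Rightarrow> 'p \<Rightarrow> 'x set" where
  "partial_subdiff g x p = limiting_subdiff (\<lambda>u. g u p) x"

definition gph_partial_subdiff ::
    "('x::real_inner \<Rightarrow> 'p \<Rightarrow> ereal) \<Rightarrow> ('x \<times> 'p \<times> 'x) set" where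
  "gph_partial_subdiff g = {(x, p, v). v \<in> partial_subdiff g x p}"

definition solution_map ::
    "('x::real_inner \<Rightarrow> 'p \<Rightarrow> 'q \<Rightarrow> 'x) \<Rightarrow> ('x \<Rightarrow> 'p \<Rightarrow> ereal) \<Rightarrow> 'x \<times> 'p \<times> 'q \<Rightarrow> 'x set" where
  "solution_map f g = (\<lambda>(v, p, q). {x. \<exists>w\<in>partial_subdiff g x p. v = f x p q + w})"

definition lipschitz_like ::
    "('m::metric_space \<Rightarrow> 'y::real_normed_vector set) \<Rightarrow> 'm \<Rightarrow> 'y \<Rightarrow> bool" where
  "lipschitz_like F mb yb \<longleftrightarrow>
     (mb, yb) \<in> gph F \<and>
     (\<exists>l>0. \<exists>U V. mb \<in> interior U \<and> yb \<in> interior V \<and>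
        (\<forall>m\<in>U. \<forall>m'\<in>U. F m \<inter> V \<subseteq> {y + (l * dist m m') *\<^sub>R b |y b. y \<in> F m' \<and> b \<in> cball 0 1}))"

definition locally_lipschitz_at ::
    "('x::real_normed_vector \<Rightarrow> 'p::metric_space \<Rightarrow> 'q::metric_space \<Rightarrow> 'x)
      \<Rightarrow> 'x \<Rightarrow> 'p \<Rightarrow> 'q \<Rightarrow> bool" where
  "locally_lipschitz_at f xb pb qb \<longleftrightarrow>
     (\<exists>L>0. \<exists>U P Q. xb \<in> interior U \<and> pb \<in> interior P \<and> qb \<in> interior Q \<and>
        (\<forall>x1\<in>U. \<forall>x2\<in>U. \<forall>p1\<in>P. \<forall>p2\<in>P. \<forall>q1\<in>Q. \<forall>q2\<in>Q.
           norm (f x1 p1 q1 - f x2 p2 q2)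
             \<le> L * (norm (x1 - x2) + dist p1 p2 + dist q1 q2)))"

definition locally_strongly_monotone ::
    "('x::real_inner \<Rightarrow> 'p::metric_space \<Rightarrow> 'q::metric_space \<Rightarrow> 'x)
      \<Rightarrow> 'x \<Rightarrow> 'p \<Rightarrow> 'q \<Rightarrow> real \<Rightarrow> bool" where
  "locally_strongly_monotone f xb pb qb \<sigma> \<longleftrightarrow>
     (\<exists>U P Q. xb \<in> interior U \<and> pb \<in> interior P \<and> qb \<in> interior Q \<and>
        (\<forall>x1\<in>U. \<forall>x2\<in>U. \<forall>p\<in>P. \<forall>q\<in>Q.
           (f x1 p q - f x2 p q) \<bullet> (x1 - x2) \<ge> \<sigma> * (norm (x1 - x2))\<^sup>2))"

definition prox_regular_with ::
    "('x::real_inner \<Rightarrow> 'p::metric_space \<Rightarrow> ereal) \<Rightarrow> 'x \<Rightarrow> 'p \<Rightarrow> 'x \<Rightarrow> real \<Rightarrow> bool" where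
  "prox_regular_with g xb pb vh r \<longleftrightarrow>
     (\<exists>U V P. \<exists>\<epsilon>>0. xb \<in> interior U \<and> vh \<in> interior V \<and> pb \<in> interior P \<and>
        (\<forall>u\<in>U. \<forall>p\<in>P. \<forall>v \<in> partial_subdiff g u p \<inter> V. g u p \<le> g xb pb + ereal \<epsilon> \<longrightarrow>
           (\<forall>x\<in>U. g x p \<ge> g u p + ereal (v \<bullet> (x - u) - r / 2 * (norm (x - u))\<^sup>2))))"

definition param_cont_prox_regular ::
    "('x::real_inner \<Rightarrow> 'p::metric_space \<Rightarrow> ereal) \<Rightarrow> 'x \<Rightarrow> 'p \<Rightarrow> 'x \<Rightarrow> bool" where
  "param_cont_prox_regular g xb pb vh \<longleftrightarrow>
     (\<exists>r>0. prox_regular_with g xb pb vh r) \<and>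
     continuous (at (xb, pb, vh) within gph_partial_subdiff g) (\<lambda>(x, p, v). g x p)"

text \<open>
  A real infimum: it is meaningful under \<^const>\<open>param_cont_prox_regular\<close>, which makes the
  set (bounded below by 0) nonempty.
\<close>

definition prox_threshold ::
    "('x::real_inner \<Rightarrow> 'p::metric_space \<Rightarrow> ereal) \<Rightarrow> 'x \<Rightarrow> 'p \<Rightarrow> 'x \<Rightarrow> real" where
  "prox_threshold g xb pb vh = Inf {r. r > 0 \<and> prox_regular_with g xb pb vh r}"

text \<open>Only the values of \<open>\<theta>\<close> on \<open>A\<close> matter.\<close>

definition single_valued_localization ::
    "('m \<Rightarrow> 'y set) \<Rightarrow> 'm set \<Rightarrow> 'y set \<Rightarrow> ('m \<Rightarrow> 'y) \<Rightarrow> bool" where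
  "single_valued_localization F A B \<theta> \<longleftrightarrow>
     \<theta> \<in> A \<rightarrow> B \<and> {(m, \<theta> m) |m. m \<in> A} = gph F \<inter> (A \<times> B)"

definition hoelder_fully_stable ::
    "('x::real_inner \<times> 'p::metric_space \<times> 'q::metric_space \<Rightarrow> 'x set)
      \<Rightarrow> 'x \<Rightarrow> 'x \<Rightarrow> 'p \<Rightarrow> 'q \<Rightarrow> bool" where
  "hoelder_fully_stable S xb vb pb qb \<longleftrightarrow>
     ((vb, pb, qb), xb) \<in> gph S \<and>
     (\<exists>V P Q U \<theta>. vb \<in> interior V \<and> pb \<in> interior P \<and> qb \<in> interior Q \<and> xb \<in> interior U \<and>
        single_valued_localization S (V \<times> P \<times> Q) U \<theta> \<and>
        (\<exists>\<kappa>>0. \<exists>l>0. \<forall>v1\<in>V. \<forall>v2\<in>V. \<forall>p1\<in>P. \<forall>p2\<in>P. \<forall>q1\<in>Q. \<forall>q2\<in>Q.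
           norm ((v1 - v2) - (2 * \<kappa>) *\<^sub>R (\<theta> (v1, p1, q1) - \<theta> (v2, p2, q2)))
             \<le> norm (v1 - v2) + l * (sqrt (dist p1 p2) + dist q1 q2)))"

end

theory Submission
  imports Defs
begin

text \<open>
  Why the theorem holds.  As the threshold is an infimum, prox-regularity holds with some constant
  \<open>r < \<sigma>\<close>.  It makes \<open>\<partial>\<^sub>xg(\<cdot>, p)\<close> locally hypomonotone with constant \<open>r\<close>, so the
  strongly monotone \<open>f\<close> makes \<open>f + \<partial>\<^sub>xg\<close> locally strongly monotone with modulus \<open>\<sigma> - r > 0\<close>.  This
  gives uniqueness and stability; what has to be worked for is the dependence on \<open>p\<close> and the
  existence of solutions.

  \<^item> Dependence on \<open>p\<close>.  The Lipschitz-like epigraphs allow a point of the graph of \<open>g(\<cdot>, p\<^sub>2)\<close> to be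
    moved to the epigraph of \<open>g(\<cdot>, p\<^sub>1)\<close> at cost \<open>O(d(p\<^sub>1, p\<^sub>2))\<close>.  Inserting the moved points in the
    two prox-regularity inequalities and adding these gives hypomonotonicity across parameters, up
    to an error \<open>C d(p\<^sub>1, p\<^sub>2)\<close> (\<open>hypomonotone_up_to_parameter\<close>).  The error is added to the
    \<^emph>\<open>square\<close> of the distance of two solutions; hence the exponent 1/2 in the conclusion.

  \<^item> Existence, without \<open>f\<close>.  For \<open>s > r\<close>, \<open>z\<close> near \<open>vh\<close> and \<open>p\<close> near \<open>pb\<close>, the inclusion
    \<open>z \<in> \<partial>\<^sub>xg(x, p) + s (x - xb)\<close> is the stationarity condition of
    \<open>g(x, p) - \<langle>z, x - xb\<rangle> + (s/2) \<parallel>x - xb\<parallel>\<^sup>2\<close>, whose near-minimizers on a small ball stay close to its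
    centre.  In infinite dimensions a minimizer need not exist a priori, because \<open>g(\<cdot>, p)\<close> need not
    be weakly lower semicontinuous.  A variational principle of Borwein-Preiss type
    (\<open>smooth_variational_principle\<close>) gives exact minimizers after an arbitrarily small quadratic
    perturbation, i.e. approximate solutions of the inclusion; by hypomonotonicity these form a
    Cauchy sequence, and the limit is a solution (\<open>resolvent\<close>).

  \<^item> Existence, with \<open>f\<close>.  Let \<open>J\<close> be the resolvent so obtained; it has Lipschitz constant
    \<open>1/(s - r)\<close>.  The solutions of \<open>v \<in> f(x, p, q) + \<partial>\<^sub>xg(x, p)\<close> are the fixed points of
    \<open>x \<mapsto> J(v - f(x, p, q) + s (x - xb))\<close>.  The inner map has the Lipschitz constant
    \<open>sqrt (s\<^sup>2 - 2 s \<sigma> + L\<^sup>2)\<close>, which is less than \<open>s - r\<close> once \<open>s\<close> is large, precisely because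
    \<open>\<sigma> > r\<close>.  The contraction principle then applies on a small ball.
\<close>

section \<open>A smooth variational principle in Hilbert spaces\<close>

text \<open>
  The sort of a Hilbert space here, \<open>{real_inner, complete_space}\<close>, is not a subsort of
  \<open>banach\<close>; so the comparison test for series has to be derived from completeness.
\<close>

lemma convergent_if_summable_steps:
  fixes Y :: "nat \<Rightarrow> 'a::{real_normed_vector, complete_space}"
  assumes step: "\<And>n. norm (Y (Suc n) - Y n) \<le> a n" and a: "summable a"
  shows "convergent Y"
proof -
  have dist: "norm (Y n - Y m) \<le> sum a {m..<n}" if "m \<le> n" for m n
    using that
  proof (induction n rule: dec_induct)
    case (step n)
    have "norm (Y (Suc n) - Y m) \<le> norm (Y (Suc n) - Y n) + norm (Y n - Y m)"
      using norm_triangle_ineq[of "Y (Suc n) - Y n" "Y n - Y m"] by simp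
    then show ?case using step assms(1)[of n] by simp
  qed simp
  have "Cauchy Y"
  proof (rule CauchyI')
    fix e :: real assume "0 < e"
    then obtain N where N: "\<And>m n. m \<ge> N \<Longrightarrow> norm (sum a {m..<n}) < e"
      using a unfolding summable_Cauchy by blast
    have "norm (Y m - Y n) < e" if "m \<ge> N" "n > m" for m n
      using dist[of m n] N[of m n] that by (simp add: norm_minus_commute)
    then show "\<exists>M. \<forall>m\<ge>M. \<forall>n>m. dist (Y m) (Y n) < e" by (auto simp: dist_norm)
  qed
  then show ?thesis by (rule Cauchy_convergent)
qed

text \<open>
  A convex combination of squared distances is, up to a constant, the squared distance to the
  barycentre.  This turns the infinitely many perturbations of the variational principle into one.
\<close>

lemma geometric_weighted_square_sums:
  fixes X :: "nat \<Rightarrow> 'a::{real_inner, complete_space}"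
  assumes X: "\<And>k. X k \<in> cball c \<eta>"
  obtains y C where "y \<in> cball c \<eta>"
    "\<And>x. (\<lambda>k. (1/2)^Suc k * (norm (x - X k))\<^sup>2) sums ((norm (x - y))\<^sup>2 + C)"
proof -
  let ?w = "\<lambda>k. (1/2::real)^Suc k"
  have w1: "?w sums 1" using power_half_series .
  then have wS: "summable ?w" and wsum: "suminf ?w = 1" by (auto simp: sums_iff)
  have bd: "norm (X k - c) \<le> \<eta>" for k
    using X[of k] by (simp add: dist_norm norm_minus_commute)
  let ?Y = "\<lambda>n. \<Sum>k<n. ?w k *\<^sub>R (X k - c)"
  have term_le: "norm (?w k *\<^sub>R (X k - c)) \<le> ?w k * \<eta>" for k
    using mult_left_mono[OF bd[of k], of "?w k"] by simp
  have "convergent ?Y"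
    by (rule convergent_if_summable_steps[OF _ summable_mult2[OF wS, of \<eta>]])
       (use term_le in \<open>simp add: sum.lessThan_Suc\<close>)
  then obtain d where d: "(\<lambda>k. ?w k *\<^sub>R (X k - c)) sums d"
    by (auto simp: convergent_def sums_def)
  have "\<eta> \<ge> 0" using order_trans[OF norm_ge_zero bd] .
  have "norm (?Y n) \<le> \<eta>" for n
  proof -
    have "norm (?Y n) \<le> (\<Sum>k<n. ?w k * \<eta>)" by (rule sum_norm_le) (rule term_le)
    also have "\<dots> = (\<Sum>k<n. ?w k) * \<eta>" by (rule sum_distrib_right[symmetric])
    also have "(\<Sum>k<n. ?w k) * \<eta> \<le> 1 * \<eta>"
      using sum_le_suminf[OF wS, of "{..<n}", unfolded wsum] \<open>\<eta> \<ge> 0\<close>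
      by (intro mult_right_mono) auto
    finally show ?thesis by simp
  qed
  then have nd: "norm d \<le> \<eta>"
    using LIMSEQ_le_const2[OF tendsto_norm[OF d[unfolded sums_def]]] by blast
  have s2: "summable (\<lambda>k. ?w k * (norm (X k - c))\<^sup>2)"
    by (rule summable_comparison_test'[where g = "\<lambda>k. ?w k * \<eta>\<^sup>2" and N = 0])
      (use wS bd in \<open>auto intro!: summable_mult2 mult_left_mono power_mono\<close>)
  then obtain M where M: "(\<lambda>k. ?w k * (norm (X k - c))\<^sup>2) sums M" unfolding summable_def by blast
  have square: "(norm (u - v))\<^sup>2 = (norm u)\<^sup>2 - 2 * (u \<bullet> v) + (norm v)\<^sup>2" for u v :: 'a
    by (simp add: power2_norm_eq_inner inner_diff inner_commute)
  show thesis
  proof (rule that[of "c + d" "M - (norm d)\<^sup>2"])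
    show "c + d \<in> cball c \<eta>" using nd by (simp add: dist_norm)
    fix x
    have "(\<lambda>k. ?w k * (norm (x - c))\<^sup>2 - 2 * ((x - c) \<bullet> (?w k *\<^sub>R (X k - c)))
             + ?w k * (norm (X k - c))\<^sup>2) sums
          (1 * (norm (x - c))\<^sup>2 - 2 * ((x - c) \<bullet> d) + M)"
      by (intro sums_add sums_diff sums_mult sums_mult2 M w1
           bounded_linear.sums[OF bounded_linear_inner_right d])
    moreover have "?w k * (norm (x - c))\<^sup>2 - 2 * ((x - c) \<bullet> (?w k *\<^sub>R (X k - c)))
             + ?w k * (norm (X k - c))\<^sup>2 = ?w k * (norm (x - X k))\<^sup>2" for k
      using square[of "x - c" "X k - c"] by (simp add: distrib_left right_diff_distrib)
    moreover have "1 * (norm (x - c))\<^sup>2 - 2 * ((x - c) \<bullet> d) + M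
        = (norm (x - (c + d)))\<^sup>2 + (M - (norm d)\<^sup>2)"
      using square[of "x - c" d] by (simp add: diff_diff_eq)
    ultimately show "(\<lambda>k. ?w k * (norm (x - X k))\<^sup>2) sums ((norm (x - (c + d)))\<^sup>2 + (M - (norm d)\<^sup>2))"
      by (simp only:)
  qed
qed

lemma approximate_minimizer:
  fixes F :: "'a \<Rightarrow> real"
  assumes "D \<noteq> {}" "\<And>x. x \<in> D \<Longrightarrow> m \<le> F x" "e > 0"
  shows "\<exists>x\<in>D. \<forall>x'\<in>D. F x \<le> F x' + e"
proof -
  have bd: "bdd_below (F ` D)" using assms(2) by (auto intro!: bdd_belowI)
  have "Inf (F ` D) < Inf (F ` D) + e" using assms(3) by simp
  then obtain x where x: "x \<in> D" "F x < Inf (F ` D) + e"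
    using cInf_lessD[of "F ` D" "Inf (F ` D) + e"] assms(1) by blast
  have "F x \<le> F x' + e" if "x' \<in> D" for x'
    using cInf_lower[OF imageI[OF that] bd] x(2) by linarith
  then show ?thesis using x(1) by blast
qed

text \<open>
  The Borwein-Preiss argument.  The point \<open>X n\<close> minimizes \<open>h\<close> plus the first \<open>n\<close> penalties
  \<open>\<mu> 2\<^sup>-\<^sup>k\<^sup>-\<^sup>1 \<parallel>\<cdot> - X k\<parallel>\<^sup>2\<close> up to an error \<open>\<mu> 8\<^sup>-\<^sup>n\<close>.  Comparing \<open>X (n+1)\<close> with \<open>X n\<close>, the
  penalty centred at \<open>X n\<close> bounds their distance geometrically, so that \<open>X\<close> converges; the limit
  minimizes \<open>h\<close> plus all penalties.  Closedness of the epigraph over \<open>D\<close> covers both the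
  closedness of \<open>D\<close>, where \<open>h\<close> is the finite part of an extended real function, and the lower
  semicontinuity of \<open>h\<close>.
\<close>

lemma smooth_variational_principle:
  fixes h :: "'a::{real_inner, complete_space} \<Rightarrow> real"
  assumes ne: "D \<noteq> {}" and sub: "D \<subseteq> cball c \<eta>" and cl: "closed (epigraph D h)"
    and bd: "bdd_below (h ` D)" and \<mu>: "\<mu> > 0"
  obtains x y where "x \<in> D" "y \<in> cball c \<eta>"
    "\<And>x'. x' \<in> D \<Longrightarrow> h x + \<mu> * (norm (x - y))\<^sup>2 \<le> h x' + \<mu> * (norm (x' - y))\<^sup>2"
proof -
  let ?w = "\<lambda>k. (1/2::real)^Suc k"
  let ?e = "\<lambda>k. \<mu> * (1/8::real)^k"
  obtain m where m: "\<And>x. x \<in> D \<Longrightarrow> m \<le> h x" using bd by (auto simp: bdd_below_def)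
  define P where "P = (\<lambda>n (x, Q). x \<in> D \<and> (\<forall>x. 0 \<le> Q x)
      \<and> (\<forall>x'\<in>D. h x + Q x \<le> h x' + Q x' + ?e n))"
  define R where "R = (\<lambda>n (x::'a, Q) (x'::'a, Q'). Q' = (\<lambda>u. Q u + \<mu> * (?w n * (norm (u - x))\<^sup>2)))"
  have ex: "\<exists>x. P n (x, Q)" if "\<forall>x. 0 \<le> Q x" for n Q
  proof -
    have "\<exists>x\<in>D. \<forall>x'\<in>D. h x + Q x \<le> h x' + Q x' + ?e n"
      by (rule approximate_minimizer[OF ne, where m = m])
         (use m that \<mu> in \<open>auto intro: add_increasing2\<close>)
    then show ?thesis using that by (auto simp: P_def)
  qed
  obtain S where S0: "snd (S 0) = (\<lambda>_. 0)" and SP: "\<And>n. P n (S n)"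
    and SR: "\<And>n. R n (S n) (S (Suc n))"
  proof -
    obtain x0 where x0: "P 0 (x0, \<lambda>_. 0)" using ex[of "\<lambda>_. 0" 0] by auto
    have "\<exists>S. (\<forall>n. (P n (S n) \<and> (n = 0 \<longrightarrow> snd (S n) = (\<lambda>_. 0))) \<and> R n (S n) (S (Suc n)))"
    proof (rule dependent_nat_choice)
      show "\<exists>x. P 0 x \<and> (0 = (0::nat) \<longrightarrow> snd x = (\<lambda>_. 0))" using x0 by force
    next
      fix S n assume S: "P n S \<and> (n = 0 \<longrightarrow> snd S = (\<lambda>_. 0))"
      obtain x Q where xQ: "S = (x, Q)" by (cases S)
      let ?Q = "\<lambda>u. Q u + \<mu> * (?w n * (norm (u - x))\<^sup>2)"
      have "\<forall>u. 0 \<le> ?Q u" using S \<mu> by (auto simp: xQ P_def)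
      from ex[OF this] obtain x' where "P (Suc n) (x', ?Q)" by blast
      then show "\<exists>y. (P (Suc n) y \<and> (Suc n = 0 \<longrightarrow> snd y = (\<lambda>_. 0))) \<and> R n S y"
        by (intro exI[of _ "(x', ?Q)"]) (auto simp: R_def xQ)
    qed
    then show thesis using that by blast
  qed
  define X where "X n = fst (S n)" for n
  have Q: "snd (S n) = (\<lambda>u. \<mu> * (\<Sum>k<n. ?w k * (norm (u - X k))\<^sup>2))" for n
  proof (induction n)
    case (Suc n)
    then show ?case using SR[of n] by (auto simp: R_def X_def split_beta algebra_simps)
  qed (simp add: S0)
  define q where "q n u = \<mu> * (\<Sum>k<n. ?w k * (norm (u - X k))\<^sup>2)" for n u
  have XD: "X n \<in> D" and Xmin: "\<And>x'. x' \<in> D \<Longrightarrow> h (X n) + q n (X n) \<le> h x' + q n x' + ?e n" for n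
    using SP[of n] Q[of n] by (auto simp: P_def X_def q_def split_beta)
  have step: "norm (X (Suc n) - X n) \<le> 2 * (1/2)^n" for n
  proof -
    have "h (X (Suc n)) + q (Suc n) (X (Suc n)) \<le> h (X n) + q (Suc n) (X n) + ?e (Suc n)"
      by (rule Xmin[OF XD])
    also have "q (Suc n) (X n) = q n (X n)" by (simp add: q_def)
    also have "h (X n) + q n (X n) \<le> h (X (Suc n)) + q n (X (Suc n)) + ?e n"
      by (rule Xmin[OF XD])
    finally have "\<mu> * (?w n * (norm (X (Suc n) - X n))\<^sup>2) \<le> \<mu> * ((1/8)^n + (1/8)^Suc n)"
      by (simp add: q_def algebra_simps)
    then have "?w n * (norm (X (Suc n) - X n))\<^sup>2 \<le> (1/8)^n + (1/8)^Suc n"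
      using \<mu> by (simp only: mult_le_cancel_left_pos)
    then have "(norm (X (Suc n) - X n))\<^sup>2 \<le> 2^Suc n * ((1/8)^n + (1/8)^Suc n)"
      by (simp add: field_simps power_one_over)
    also have "\<dots> = 9/4 * (1/4)^n"
    proof -
      have "(2::real)^n * (1/8)^n = (1/4)^n" by (simp flip: power_mult_distrib)
      then show ?thesis by (simp add: algebra_simps)
    qed
    also have "\<dots> \<le> 4 * (1/4)^n" by simp
    also have "\<dots> = (2 * (1/2)^n)\<^sup>2"
    proof -
      have "((1/2::real)^n)\<^sup>2 = ((1/2)\<^sup>2)^n" by (simp only: power_mult[symmetric] mult.commute)
      then show ?thesis unfolding power_mult_distrib by (simp add: power2_eq_square)
    qed
    finally show ?thesis by (rule power2_le_imp_le) simp
  qed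
  have "convergent X"
    by (rule convergent_if_summable_steps[where a = "\<lambda>n. 2 * (1/2)^n"])
       (use step in \<open>auto intro!: summable_mult summable_geometric\<close>)
  then obtain x where x: "X \<longlonglongrightarrow> x" by (auto simp: convergent_def)
  have "X k \<in> cball c \<eta>" for k using XD sub by blast
  then obtain y C where y: "y \<in> cball c \<eta>"
    and sums: "\<And>x. (\<lambda>k. ?w k * (norm (x - X k))\<^sup>2) sums ((norm (x - y))\<^sup>2 + C)"
    using geometric_weighted_square_sums[of X c \<eta>] by blast
  define q' where "q' u = \<mu> * ((norm (u - y))\<^sup>2 + C)" for u
  have qlim: "(\<lambda>n. q n u) \<longlonglongrightarrow> q' u" for u
    unfolding q_def q'_def using sums[of u] unfolding sums_def by (rule tendsto_mult_left)
  have qmono: "q n u \<le> q k u" if "n \<le> k" for n k u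
    unfolding q_def using \<mu> that by (intro mult_left_mono sum_mono2) auto
  have qle: "q n u \<le> q' u" for n u
    using qlim[of u] by (rule LIMSEQ_le_const) (use qmono in blast)
  have e0: "?e \<longlonglongrightarrow> 0" using tendsto_mult_left[OF LIMSEQ_realpow_zero[of "1/8::real"], of \<mu>] by simp
  have main: "x \<in> D \<and> h x \<le> h u + q' u - q j x" if u: "u \<in> D" for u j
  proof -
    have "\<forall>\<^sub>F n in sequentially. (X n, h u + q' u + ?e n - q j (X n)) \<in> epigraph D h"
      using eventually_ge_at_top[of j]
    proof eventually_elim
      case (elim n)
      have "h (X n) + q j (X n) \<le> h (X n) + q n (X n)" using qmono[OF elim] by simp
      also have "\<dots> \<le> h u + q n u + ?e n" by (rule Xmin[OF u])
      also have "\<dots> \<le> h u + q' u + ?e n" using qle by simp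
      finally show ?case using XD by (simp add: epigraph_def)
    qed
    moreover have "(\<lambda>n. q j (X n)) \<longlonglongrightarrow> q j x" unfolding q_def
      by (intro tendsto_intros x)
    then have "(\<lambda>n. (X n, h u + q' u + ?e n - q j (X n))) \<longlonglongrightarrow> (x, h u + q' u + 0 - q j x)"
      by (intro tendsto_intros x e0)
    ultimately have "(x, h u + q' u + 0 - q j x) \<in> epigraph D h"
      using cl by (intro Lim_in_closed_set) auto
    then show ?thesis by (simp add: epigraph_def)
  qed
  show thesis
  proof
    show "x \<in> D" using main[OF XD[of 0]] by blast
    show "y \<in> cball c \<eta>" by fact
    fix u assume u: "u \<in> D"
    have "q' x \<le> h u + q' u - h x"
      by (rule LIMSEQ_le_const2[OF qlim]) (use main[OF u] in \<open>auto simp: algebra_simps\<close>)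
    then show "h x + \<mu> * (norm (x - y))\<^sup>2 \<le> h u + \<mu> * (norm (u - y))\<^sup>2"
      by (simp add: q'_def algebra_simps)
  qed
qed

section \<open>Proximal subgradients\<close>

text \<open>
  The quadratic term is \<open>o(\<parallel>y - x\<parallel>)\<close>.
\<close>

lemma proximal_subgradient_regular:
  fixes \<phi> :: "'a::real_inner \<Rightarrow> ereal"
  assumes fin: "\<bar>\<phi> x\<bar> \<noteq> \<infinity>" and \<delta>: "\<delta> > 0"
    and le: "\<And>y. y \<in> ball x \<delta> \<Longrightarrow> \<phi> x + ereal (v \<bullet> (y - x) - c * (norm (y - x))\<^sup>2) \<le> \<phi> y"
  shows "v \<in> regular_subdiff \<phi> x"
proof -
  obtain t where t: "\<phi> x = ereal t" using fin by (cases "\<phi> x") auto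
  have "\<forall>\<^sub>F y in at x. e < (\<phi> y - \<phi> x - ereal (v \<bullet> (y - x))) / ereal (norm (y - x))"
    if neg: "e < 0" for e
  proof -
    obtain e' where e': "e < ereal e'" "e' < 0"
      using ereal_dense2[OF neg] by (auto simp: zero_ereal_def)
    define \<rho> where "\<rho> = min \<delta> (- e' / (\<bar>c\<bar> + 1))"
    have \<rho>: "\<rho> > 0" using \<delta> e' by (auto simp: \<rho>_def divide_neg_pos)
    have "e < (\<phi> y - \<phi> x - ereal (v \<bullet> (y - x))) / ereal (norm (y - x))"
      if y: "y \<noteq> x" "dist y x < \<rho>" for y
    proof (cases "\<phi> y")
      case (real s)
      let ?n = "norm (y - x)"
      have n: "?n > 0" "?n < \<delta>" "?n < - e' / (\<bar>c\<bar> + 1)"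
        using y by (auto simp: dist_norm \<rho>_def)
      have "(\<bar>c\<bar> + 1) * ?n < - e'" using n(3) by (simp add: field_simps)
      moreover have "c * ?n \<le> \<bar>c\<bar> * ?n" using n by (intro mult_right_mono) auto
      moreover have "(\<bar>c\<bar> + 1) * ?n = \<bar>c\<bar> * ?n + ?n" by (simp add: distrib_right)
      ultimately have "e' < - c * ?n" using n(1) by linarith
      then have "e' * ?n < - c * ?n * ?n" using n(1) by (rule mult_strict_right_mono)
      also have "\<dots> = - c * ?n\<^sup>2" by (simp add: power2_eq_square)
      also have "- c * ?n\<^sup>2 \<le> s - t - v \<bullet> (y - x)"
        using le[of y] n(2) real t by (auto simp: dist_norm norm_minus_commute)
      finally have "e' < (s - t - v \<bullet> (y - x)) / ?n" using n(1) by (simp add: field_simps)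
      then have "ereal e' < ereal ((s - t - v \<bullet> (y - x)) / ?n)" by simp
      also have "\<dots> = (\<phi> y - \<phi> x - ereal (v \<bullet> (y - x))) / ereal ?n"
        using n(1) by (simp add: real t)
      finally show ?thesis using e'(1) by (rule less_trans[rotated])
    next
      case PInf
      then show ?thesis using y e' by (auto simp: t)
    next
      case MInf
      then show ?thesis using le[of y] y by (auto simp: t dist_commute \<rho>_def)
    qed
    then show ?thesis unfolding eventually_at using \<rho> by blast
  qed
  then show ?thesis using fin by (auto simp: regular_subdiff_def le_Liminf_iff)
qed

lemma regular_subdiff_subset_limiting: "regular_subdiff \<phi> x \<subseteq> limiting_subdiff \<phi> x"
proof
  fix v assume v: "v \<in> regular_subdiff \<phi> x"
  then show "v \<in> limiting_subdiff \<phi> x"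
    unfolding limiting_subdiff_def weakly_converges_def mem_Collect_eq
    by (intro conjI exI[of _ "\<lambda>_::nat. x"] exI[of _ "\<lambda>_::nat. v"]) (auto simp: regular_subdiff_def)
qed

lemmas proximal_subgradient_limiting =
  subsetD[OF regular_subdiff_subset_limiting proximal_subgradient_regular]

section \<open>Estimates in Hilbert spaces\<close>

text \<open>
  Adding \<open>s\<close> times the identity to an \<open>r\<close>-hypomonotone map gives a strongly monotone map with
  modulus \<open>s - r\<close>, so its inverse is Lipschitz.
\<close>

lemma shifted_hypomonotone_lipschitz:
  fixes x1 x2 :: "'a::real_inner"
  assumes "- r * (norm (x1 - x2))\<^sup>2 \<le> (w1 - w2) \<bullet> (x1 - x2)"
  shows "(s - r) * norm (x1 - x2) \<le> norm ((w1 + s *\<^sub>R (x1 - xb)) - (w2 + s *\<^sub>R (x2 - xb)))"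
    (is "_ \<le> norm ?z")
proof (cases "x1 = x2")
  case False
  let ?n = "norm (x1 - x2)"
  have "?z = (w1 - w2) + s *\<^sub>R (x1 - x2)" by (simp add: algebra_simps)
  then have "?z \<bullet> (x1 - x2) = (w1 - w2) \<bullet> (x1 - x2) + s * ?n\<^sup>2"
    by (simp only: inner_add_left inner_scaleR_left power2_norm_eq_inner)
  with assms have "(s - r) * ?n\<^sup>2 \<le> ?z \<bullet> (x1 - x2)" by (simp add: left_diff_distrib)
  also have "\<dots> \<le> norm ?z * ?n" by (rule norm_cauchy_schwarz)
  finally have "((s - r) * ?n) * ?n \<le> norm ?z * ?n" by (simp add: power2_eq_square)
  then show ?thesis using False by (subst (asm) mult_le_cancel_right_pos) auto
qed simp

text \<open>
  Here \<open>v\<close> and \<open>x\<close> stand for the differences of two right-hand sides and of the two solutions, and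
  \<open>d1\<close>, \<open>d2\<close> for the distances of the parameters.  Expanding the square on the left, the hypothesis
  leaves \<open>- 4\<kappa>\<^sup>2 \<parallel>x\<parallel>\<^sup>2\<close>, which absorbs the mixed term \<open>4\<kappa> L d2 \<parallel>x\<parallel>\<close> at the price of \<open>(L d2)\<^sup>2\<close>.
  The term \<open>4\<kappa> A d1\<close> has to be moved into the square and becomes a square root.
\<close>

lemma hoelder_estimate:
  fixes v x :: "'a::real_inner"
  assumes mono: "2 * \<kappa> * (norm x)\<^sup>2 - A * d1 - L * d2 * norm x \<le> v \<bullet> x"
    and pos: "\<kappa> > 0" "A \<ge> 0" "L \<ge> 0" "d1 \<ge> 0" "d2 \<ge> 0"
  shows "norm (v - (2 * \<kappa>) *\<^sub>R x) \<le> norm v + (sqrt (4 * \<kappa> * A) + L) * (sqrt d1 + d2)"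
proof -
  have "4 * \<kappa> * (2 * \<kappa> * (norm x)\<^sup>2 - A * d1 - L * d2 * norm x) \<le> 4 * \<kappa> * (v \<bullet> x)"
    using mono pos by (intro mult_left_mono) auto
  moreover have "0 \<le> (2 * \<kappa> * norm x - L * d2)\<^sup>2" by simp
  moreover have "(norm (v - (2 * \<kappa>) *\<^sub>R x))\<^sup>2 = (norm v)\<^sup>2 - 4 * \<kappa> * (v \<bullet> x) + 4 * \<kappa>\<^sup>2 * (norm x)\<^sup>2"
    unfolding power2_norm_eq_inner
    by (simp add: inner_diff_left inner_diff_right inner_commute power2_eq_square)
  ultimately have "(norm (v - (2 * \<kappa>) *\<^sub>R x))\<^sup>2 \<le> (norm v)\<^sup>2 + 4 * \<kappa> * A * d1 + (L * d2)\<^sup>2"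
    by (simp add: power2_eq_square algebra_simps)
  also have "\<dots> = (norm v)\<^sup>2 + (sqrt (4 * \<kappa> * A) * sqrt d1)\<^sup>2 + (L * d2)\<^sup>2"
    using pos by (simp add: power_mult_distrib)
  also have "\<dots> \<le> (norm v + sqrt (4 * \<kappa> * A) * sqrt d1 + L * d2)\<^sup>2"
  proof -
    have sq: "u\<^sup>2 + v\<^sup>2 + w\<^sup>2 \<le> (u + v + w)\<^sup>2" if "u \<ge> 0" "v \<ge> 0" "w \<ge> 0" for u v w :: real
      using mult_nonneg_nonneg[OF that(1,2)] mult_nonneg_nonneg[OF that(1,3)]
        mult_nonneg_nonneg[OF that(2,3)] by (simp add: power2_eq_square algebra_simps)
    show ?thesis using pos by (intro sq) auto
  qed
  finally have "norm (v - (2 * \<kappa>) *\<^sub>R x) \<le> norm v + sqrt (4 * \<kappa> * A) * sqrt d1 + L * d2"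
    by (rule power2_le_imp_le) (use pos in auto)
  also have "\<dots> \<le> norm v + (sqrt (4 * \<kappa> * A) + L) * (sqrt d1 + d2)"
    using mult_nonneg_nonneg[of "sqrt (4 * \<kappa> * A)" d2] mult_nonneg_nonneg[of L "sqrt d1"] pos
    by (simp add: algebra_simps)
  finally show ?thesis .
qed

text \<open>
  Used for \<open>x\<close> a difference of two points and \<open>y\<close> the corresponding difference of values of \<open>f\<close>.
\<close>

lemma strongly_monotone_shift_contracts:
  fixes x y :: "'a::real_inner"
  assumes mono: "\<sigma> * (norm x)\<^sup>2 \<le> y \<bullet> x" and lip: "norm y \<le> L * norm x"
    and s: "s \<ge> 0"
  shows "norm (s *\<^sub>R x - y) \<le> sqrt (s\<^sup>2 - 2 * s * \<sigma> + L\<^sup>2) * norm x"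
proof -
  have "(norm y)\<^sup>2 \<le> L\<^sup>2 * (norm x)\<^sup>2"
    using power_mono[OF lip norm_ge_zero, of 2] by (simp add: power_mult_distrib)
  moreover have "2 * s * (\<sigma> * (norm x)\<^sup>2) \<le> 2 * s * (y \<bullet> x)"
    using mono s by (intro mult_left_mono) auto
  moreover have "(norm (s *\<^sub>R x - y))\<^sup>2 = s\<^sup>2 * (norm x)\<^sup>2 - 2 * s * (y \<bullet> x) + (norm y)\<^sup>2"
    unfolding power2_norm_eq_inner
    by (simp add: inner_diff_left inner_diff_right inner_commute power2_eq_square)
  ultimately have "(norm (s *\<^sub>R x - y))\<^sup>2 \<le> (s\<^sup>2 - 2 * s * \<sigma> + L\<^sup>2) * (norm x)\<^sup>2"
    by (simp add: algebra_simps)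
  then have "sqrt ((norm (s *\<^sub>R x - y))\<^sup>2) \<le> sqrt ((s\<^sup>2 - 2 * s * \<sigma> + L\<^sup>2) * (norm x)\<^sup>2)"
    by (rule real_sqrt_le_mono)
  then show ?thesis by (simp add: real_sqrt_mult)
qed

section \<open>Hypomonotonicity and closedness of the subdifferential\<close>

text \<open>
  What the assumptions on \<open>g\<close> provide, on balls of one radius \<open>a\<close>: all later arguments use only
  this.  The number \<open>c\<close> is the width of the band around \<open>G = g(xb, pb)\<close> in which the Lipschitz
  property of the epigraphs is available, so \<open>value_lower\<close> and \<open>value_upper\<close> say that it is
  available at the points of the graph of the subdifferential.
\<close>

locale prox_regular_data =
  fixes g :: "'x::{real_inner, complete_space} \<Rightarrow> 'p::metric_space \<Rightarrow> ereal"
    and xb vh :: 'x and pb :: 'p and G r l a c :: real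
  assumes pos: "a > 0" "c > 0" "l > 0" "r > 0"
    and base_value: "g xb pb = ereal G"
    and base_subgradient: "vh \<in> partial_subdiff g xb pb"
    and closed_epi: "\<And>p. p \<in> ball pb a \<Longrightarrow> closed (epi (\<lambda>x. g x p))"
    and value_lower: "\<And>x p. \<lbrakk>x \<in> ball xb a; p \<in> ball pb a\<rbrakk> \<Longrightarrow> ereal (G - c) < g x p"
    and value_upper: "\<And>x p w. \<lbrakk>x \<in> ball xb a; p \<in> ball pb a; w \<in> ball vh a;
      w \<in> partial_subdiff g x p\<rbrakk> \<Longrightarrow> g x p < ereal (G + c)"
    and prox: "\<And>x p w x'. \<lbrakk>x \<in> ball xb a; p \<in> ball pb a; w \<in> ball vh a;
      w \<in> partial_subdiff g x p; x' \<in> ball xb a\<rbrakk>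
      \<Longrightarrow> g x p + ereal (w \<bullet> (x' - x) - r / 2 * (norm (x' - x))\<^sup>2) \<le> g x' p"
    and epi_lip: "\<And>p p' x t. \<lbrakk>p \<in> ball pb a; p' \<in> ball pb a; x \<in> ball xb a; \<bar>t - G\<bar> < c;
      g x p \<le> ereal t\<rbrakk>
      \<Longrightarrow> \<exists>x'. norm (x' - x) \<le> l * dist p p' \<and> g x' p' \<le> ereal (t + l * dist p p')"
begin

definition local_graph :: "real \<Rightarrow> ('x \<times> 'p \<times> 'x) set" where
  "local_graph b = {(x, p, w). x \<in> ball xb b \<and> p \<in> ball pb b \<and> w \<in> ball vh b \<and> w \<in> partial_subdiff g x p}"

lemma local_graph_mono: "b \<le> b' \<Longrightarrow> local_graph b \<subseteq> local_graph b'"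
  by (auto simp: local_graph_def)

lemma finite_value:
  assumes "(x, p, w) \<in> local_graph a"
  obtains t where "g x p = ereal t" "\<bar>t - G\<bar> < c"
proof -
  have "ereal (G - c) < g x p" "g x p < ereal (G + c)"
    using assms value_lower[of x p] value_upper[of x p w] by (auto simp: local_graph_def)
  then show thesis by (cases "g x p") (auto intro!: that simp: abs_less_iff)
qed

text \<open>
  The prox-regularity inequality at \<open>(x1, p1)\<close>, tested at \<open>x2\<close>, although the value there is
  known for \<open>p2\<close> only.  The epigraph of \<open>g(\<cdot>, p1)\<close> has a point within \<open>l d(p1, p2)\<close> of
  \<open>(x2, g(x2, p2))\<close>; passing between \<open>x2\<close> and that point changes each term by \<open>O(d(p1, p2))\<close>.
\<close>

lemma prox_two_parameters:
  assumes b: "b \<le> a / 2" "2 * l * b \<le> a / 2"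
    and 1: "(x1, p1, w1) \<in> local_graph b" and 2: "(x2, p2, w2) \<in> local_graph b"
    and t: "g x1 p1 = ereal t1" "g x2 p2 = ereal t2"
  shows "t1 + w1 \<bullet> (x2 - x1) - r / 2 * (norm (x2 - x1))\<^sup>2
     \<le> t2 + (1 + norm vh + a + 5 * r * a / 2) * (l * dist p1 p2)"
proof -
  let ?\<tau> = "l * dist p1 p2"
  have ba: "b \<le> a" using b pos by simp
  note mem = 1[unfolded local_graph_def] 2[unfolded local_graph_def]
  have a1: "(x1, p1, w1) \<in> local_graph a" and a2: "(x2, p2, w2) \<in> local_graph a"
    using 1 2 local_graph_mono[OF ba] by auto
  have "\<bar>t2 - G\<bar> < c" using finite_value[OF a2] t by auto
  with epi_lip[of p2 p1 x2 t2] t a2 a1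
  obtain x' where x': "norm (x' - x2) \<le> ?\<tau>" "g x' p1 \<le> ereal (t2 + ?\<tau>)"
    by (auto simp: local_graph_def dist_commute)
  have "dist p1 p2 < 2 * b"
    using mem dist_triangle_half_r[of pb p1 "2 * b" p2] by auto
  then have "?\<tau> < l * (2 * b)" using pos by (intro mult_strict_left_mono) auto
  also have "l * (2 * b) = 2 * l * b" by simp
  finally have "?\<tau> < 2 * l * b" .
  then have \<tau>: "0 \<le> ?\<tau>" "?\<tau> < a / 2" using b(2) pos by (simp, linarith)
  have nx: "norm (x1 - xb) < b" "norm (x2 - xb) < b" "norm (w1 - vh) < b"
    using mem by (auto simp: dist_norm norm_minus_commute)
  have "norm (x' - xb) \<le> norm (x' - x2) + norm (x2 - xb)"
    using norm_triangle_ineq[of "x' - x2" "x2 - xb"] by simp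
  also have "\<dots> < a" using x'(1) \<tau> nx b by linarith
  finally have "x' \<in> ball xb a" by (simp add: dist_norm norm_minus_commute)
  then have "g x1 p1 + ereal (w1 \<bullet> (x' - x1) - r / 2 * (norm (x' - x1))\<^sup>2) \<le> ereal (t2 + ?\<tau>)"
    using a1 prox[of x1 p1 w1 x'] x'(2) by (auto simp: local_graph_def intro: order_trans)
  then have main: "t1 + w1 \<bullet> (x' - x1) - r / 2 * (norm (x' - x1))\<^sup>2 \<le> t2 + ?\<tau>"
    by (simp add: t)
  let ?n = "norm (x2 - x1)"
  have n: "?n \<le> 2 * a"
    using norm_triangle_ineq4[of "x2 - xb" "x1 - xb"] nx ba by simp
  have "norm (x' - x1) \<le> ?n + ?\<tau>"
    using norm_triangle_ineq[of "x' - x2" "x2 - x1"] x'(1) by simp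
  then have "(norm (x' - x1))\<^sup>2 \<le> (?n + ?\<tau>)\<^sup>2" by (intro power_mono) auto
  also have "\<dots> = ?n\<^sup>2 + (2 * ?n + ?\<tau>) * ?\<tau>" by (simp add: power2_eq_square algebra_simps)
  also have "\<dots> \<le> ?n\<^sup>2 + (5 * a) * ?\<tau>"
    using n \<tau> pos by (intro add_left_mono mult_right_mono) auto
  finally have sq: "r / 2 * (norm (x' - x1))\<^sup>2 \<le> r / 2 * (?n\<^sup>2 + 5 * a * ?\<tau>)"
    using pos by (intro mult_left_mono) auto
  have nw: "norm w1 \<le> norm vh + a"
    using norm_triangle_ineq[of "w1 - vh" vh] nx ba by simp
  have "- (w1 \<bullet> (x' - x2)) \<le> norm w1 * norm (x' - x2)"
    using Cauchy_Schwarz_ineq2[of w1 "x' - x2"] by simp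
  also have "\<dots> \<le> (norm vh + a) * ?\<tau>" using nw x'(1) pos by (intro mult_mono) auto
  finally have "w1 \<bullet> (x2 - x1) - (norm vh + a) * ?\<tau> \<le> w1 \<bullet> (x' - x1)"
    by (simp add: inner_diff_right)
  with main sq show ?thesis by (simp add: algebra_simps)
qed

text \<open>
  Add the previous inequality and the one with the two points exchanged.
\<close>

lemma hypomonotone_up_to_parameter:
  obtains b C where "0 < b" "b \<le> a" "0 \<le> C"
    "\<And>x1 p1 w1 x2 p2 w2. \<lbrakk>(x1, p1, w1) \<in> local_graph b; (x2, p2, w2) \<in> local_graph b\<rbrakk>
       \<Longrightarrow> - r * (norm (x1 - x2))\<^sup>2 - C * dist p1 p2 \<le> (w1 - w2) \<bullet> (x1 - x2)"
proof
  let ?b = "min (a / 2) (a / (4 * l))" and ?K = "1 + norm vh + a + 5 * r * a / 2"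
  show "0 < ?b" "?b \<le> a" "0 \<le> 2 * ?K * l" using pos by (auto intro!: mult_nonneg_nonneg add_nonneg_nonneg)
  have "?b \<le> a / (4 * l)" by simp
  then have "?b * (4 * l) \<le> a" using pos by (subst (asm) pos_le_divide_eq) auto
  then have b: "?b \<le> a / 2" "2 * l * ?b \<le> a / 2" by (simp_all add: mult_ac)
  fix x1 p1 w1 x2 p2 w2 assume 1: "(x1, p1, w1) \<in> local_graph ?b" and 2: "(x2, p2, w2) \<in> local_graph ?b"
  have a: "(x1, p1, w1) \<in> local_graph a" "(x2, p2, w2) \<in> local_graph a"
    using 1 2 local_graph_mono[OF \<open>?b \<le> a\<close>] by auto
  obtain t1 t2 where t: "g x1 p1 = ereal t1" "g x2 p2 = ereal t2"
    using finite_value[OF a(1)] finite_value[OF a(2)] by metis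
  have "t1 + w1 \<bullet> (x2 - x1) - r / 2 * (norm (x2 - x1))\<^sup>2 \<le> t2 + ?K * (l * dist p1 p2)"
    "t2 + w2 \<bullet> (x1 - x2) - r / 2 * (norm (x1 - x2))\<^sup>2 \<le> t1 + ?K * (l * dist p2 p1)"
    using prox_two_parameters[OF b 1 2 t] prox_two_parameters[OF b 2 1 t(2) t(1)] by auto
  moreover have "norm (x2 - x1) = norm (x1 - x2)" "dist p2 p1 = dist p1 p2"
    by (simp_all add: norm_minus_commute dist_commute)
  ultimately have "w1 \<bullet> (x2 - x1) + w2 \<bullet> (x1 - x2) - r * (norm (x1 - x2))\<^sup>2
      \<le> 2 * (?K * (l * dist p1 p2))" by (simp only:)
  moreover have "w1 \<bullet> (x2 - x1) + w2 \<bullet> (x1 - x2) = - ((w1 - w2) \<bullet> (x1 - x2))"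
    by (simp add: inner_diff algebra_simps)
  ultimately show "- r * (norm (x1 - x2))\<^sup>2 - 2 * ?K * l * dist p1 p2 \<le> (w1 - w2) \<bullet> (x1 - x2)"
    by linarith
qed

text \<open>
  Prox-regularity makes the graph closed under norm limits: the inequalities at
  \<open>X k\<close> put the points \<open>(X k, g(u, p) - \<dots>)\<close> into the closed epigraph of \<open>g(\<cdot>, p)\<close>, and in the limit
  they say that \<open>w\<close> is a proximal subgradient.
\<close>

lemma subgradient_limit:
  assumes X: "X \<longlonglongrightarrow> x" and W: "W \<longlonglongrightarrow> w" and mem: "\<And>k::nat. (X k, p, W k) \<in> local_graph a"
    and x: "x \<in> ball xb a"
  shows "w \<in> partial_subdiff g x p"
proof -
  have p: "p \<in> ball pb a" using mem[of 0] by (simp add: local_graph_def)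
  have lim: "g x p \<le> ereal (t - w \<bullet> (u - x) + r / 2 * (norm (u - x))\<^sup>2)"
    if u: "u \<in> ball xb a" and t: "g u p = ereal t" for u t
  proof -
    let ?t = "\<lambda>k. t - W k \<bullet> (u - X k) + r / 2 * (norm (u - X k))\<^sup>2"
    have "(X k, ?t k) \<in> epi (\<lambda>x. g x p)" for k
    proof -
      obtain s where s: "g (X k) p = ereal s" using finite_value[OF mem] by metis
      have "g (X k) p + ereal (W k \<bullet> (u - X k) - r / 2 * (norm (u - X k))\<^sup>2) \<le> g u p"
        using mem[of k] u by (intro prox) (auto simp: local_graph_def)
      then show ?thesis by (simp add: epi_def s t)
    qed
    moreover have "(\<lambda>k. (X k, ?t k)) \<longlonglongrightarrow> (x, t - w \<bullet> (u - x) + r / 2 * (norm (u - x))\<^sup>2)"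
      by (intro tendsto_intros X W)
    ultimately have "(x, t - w \<bullet> (u - x) + r / 2 * (norm (u - x))\<^sup>2) \<in> epi (\<lambda>x. g x p)"
      by (rule closed_sequentially[OF closed_epi[OF p]])
    then show ?thesis by (simp add: epi_def)
  qed
  obtain t0 where "g (X 0) p = ereal t0" using finite_value[OF mem] by metis
  with lim[of "X 0" t0] mem[of 0] have "g x p \<noteq> \<infinity>" by (auto simp: local_graph_def)
  moreover have "g x p \<noteq> - \<infinity>" using value_lower[OF x p] by auto
  ultimately obtain s where s: "g x p = ereal s" by (cases "g x p") auto
  show ?thesis unfolding partial_subdiff_def
  proof (rule proximal_subgradient_limiting)
    show "\<bar>g x p\<bar> \<noteq> \<infinity>" by (simp add: s)
    show "a - dist xb x > 0" using x by simp
    fix u assume "u \<in> ball x (a - dist xb x)"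
    then have u: "u \<in> ball xb a" using dist_triangle[of xb u x] by simp
    show "g x p + ereal (w \<bullet> (u - x) - r / 2 * (norm (u - x))\<^sup>2) \<le> g u p"
      using lim[OF u] value_lower[OF u p] by (cases "g u p") (auto simp: s)
  qed
qed

text \<open>
  The quadratic minorant of \<open>g(\<cdot>, pb)\<close> at \<open>xb\<close> persists, up to \<open>\<nu>\<close>, on a ball whose radius does
  not depend on \<open>\<nu>\<close>.  Where \<open>g(x, p)\<close> is near \<open>G\<close>, the point \<open>(x, g(x, p))\<close> is moved to the epigraph
  of \<open>g(\<cdot>, pb)\<close>; where it is larger, the minorant does not exceed it because \<open>\<eta>\<close> is small.
\<close>

lemma perturbed_lower_bound:
  assumes \<eta>: "0 < \<eta>" "2 * \<eta> < a" "norm vh * \<eta> \<le> c" and \<nu>: "\<nu> > 0"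
  obtains b where "0 < b" "b \<le> a" "\<And>p x. \<lbrakk>p \<in> ball pb b; x \<in> cball xb \<eta>\<rbrakk>
    \<Longrightarrow> ereal (G + vh \<bullet> (x - xb) - r / 2 * (norm (x - xb))\<^sup>2 - \<nu>) \<le> g x p"
proof
  let ?K = "1 + norm vh + 3 * r * \<eta> / 2"
  define b where "b = min a (min (\<eta> / l) (\<nu> / (l * ?K)))"
  have K: "?K > 0" using pos \<eta> by (intro add_pos_nonneg) auto
  show "0 < b" "b \<le> a" using pos \<eta> \<nu> K by (auto simp: b_def)
  fix p x assume p: "p \<in> ball pb b" and x: "x \<in> cball xb \<eta>"
  let ?\<tau> = "l * dist p pb"
  have "dist p pb \<le> \<eta> / l" "dist p pb \<le> \<nu> / (l * ?K)"
    using p by (auto simp: b_def dist_commute)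
  then have \<tau>: "0 \<le> ?\<tau>" "?\<tau> \<le> \<eta>" "?K * ?\<tau> \<le> \<nu>"
    using pos K by (auto simp: pos_le_divide_eq mult_ac)
  have nx: "norm (x - xb) \<le> \<eta>" using x by (simp add: dist_norm norm_minus_commute)
  have xa: "x \<in> ball xb a" and pa: "p \<in> ball pb a" using x \<eta> p \<open>b \<le> a\<close> by auto
  have vx: "vh \<bullet> (x - xb) \<le> c"
  proof -
    have "vh \<bullet> (x - xb) \<le> norm vh * norm (x - xb)" by (rule norm_cauchy_schwarz)
    also have "\<dots> \<le> norm vh * \<eta>" using nx by (intro mult_left_mono) auto
    finally show ?thesis using \<eta>(3) by simp
  qed
  let ?q = "r / 2 * (norm (x - xb))\<^sup>2"
  have q: "0 \<le> ?q" using pos by simp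
  show "ereal (G + vh \<bullet> (x - xb) - ?q - \<nu>) \<le> g x p"
  proof (cases "g x p < ereal (G + c)")
    case False
    then have "ereal (G + c) \<le> g x p" by simp
    moreover have "G + vh \<bullet> (x - xb) - ?q - \<nu> \<le> G + c" using vx q \<nu> by simp
    ultimately show ?thesis by (meson order_trans ereal_less_eq(3))
  next
    case True
    then obtain t where t: "g x p = ereal t" "\<bar>t - G\<bar> < c"
      using value_lower[OF xa pa] by (cases "g x p") auto
    obtain x' where x': "norm (x' - x) \<le> ?\<tau>" "g x' pb \<le> ereal (t + ?\<tau>)"
      using epi_lip[of p pb x t] pa xa t pos by auto
    have nx': "norm (x' - xb) \<le> norm (x - xb) + ?\<tau>"
      using norm_triangle_ineq[of "x' - x" "x - xb"] x'(1) by simp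
    then have "x' \<in> ball xb a" using nx \<tau> \<eta> by (simp add: dist_norm norm_minus_commute)
    then have "g xb pb + ereal (vh \<bullet> (x' - xb) - r / 2 * (norm (x' - xb))\<^sup>2) \<le> g x' pb"
      using base_subgradient pos by (intro prox) auto
    then have "g xb pb + ereal (vh \<bullet> (x' - xb) - r / 2 * (norm (x' - xb))\<^sup>2) \<le> ereal (t + ?\<tau>)"
      using x'(2) by (rule order_trans)
    then have main: "G + vh \<bullet> (x' - xb) - r / 2 * (norm (x' - xb))\<^sup>2 \<le> t + ?\<tau>"
      by (simp add: base_value)
    have "(norm (x' - xb))\<^sup>2 \<le> (norm (x - xb) + ?\<tau>)\<^sup>2" using nx' by (intro power_mono) auto
    also have "\<dots> = (norm (x - xb))\<^sup>2 + (2 * norm (x - xb) + ?\<tau>) * ?\<tau>"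
      by (simp add: power2_eq_square algebra_simps)
    also have "\<dots> \<le> (norm (x - xb))\<^sup>2 + (3 * \<eta>) * ?\<tau>"
      using nx \<tau> by (intro add_left_mono mult_right_mono) auto
    finally have "r / 2 * (norm (x' - xb))\<^sup>2 \<le> r / 2 * ((norm (x - xb))\<^sup>2 + 3 * \<eta> * ?\<tau>)"
      using pos by (intro mult_left_mono) auto
    moreover have "- (vh \<bullet> (x' - x)) \<le> norm vh * ?\<tau>"
    proof -
      have "- (vh \<bullet> (x' - x)) \<le> norm vh * norm (x' - x)"
        using Cauchy_Schwarz_ineq2[of vh "x' - x"] by simp
      also have "\<dots> \<le> norm vh * ?\<tau>" using x'(1) by (intro mult_left_mono) auto
      finally show ?thesis .
    qed
    moreover have "vh \<bullet> (x' - xb) = vh \<bullet> (x - xb) + vh \<bullet> (x' - x)" by (simp add: inner_diff_right)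
    ultimately have "G + vh \<bullet> (x - xb) - ?q - ?K * ?\<tau> \<le> t"
      using main by (simp add: algebra_simps)
    with \<tau>(3) show ?thesis by (simp add: t)
  qed
qed

lemma perturbed_point:
  assumes "\<tau> > 0"
  obtains b where "0 < b" "b \<le> a"
    "\<And>p. p \<in> ball pb b \<Longrightarrow> \<exists>x\<in>cball xb \<tau>. g x p \<le> ereal (G + \<tau>)"
proof
  let ?b = "min a (\<tau> / l)"
  show "0 < ?b" "?b \<le> a" using assms pos by auto
  fix p assume p: "p \<in> ball pb ?b"
  then have "l * dist pb p \<le> \<tau>" using pos by (auto simp: field_simps)
  moreover obtain x where "norm (x - xb) \<le> l * dist pb p" "g x p \<le> ereal (G + l * dist pb p)"
    using epi_lip[of pb p xb G] p pos base_value by auto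
  ultimately have "x \<in> cball xb \<tau>" "g x p \<le> ereal (G + \<tau>)"
    by (auto simp: dist_norm norm_minus_commute elim!: order_trans)
  then show "\<exists>x\<in>cball xb \<tau>. g x p \<le> ereal (G + \<tau>)" by blast
qed

section \<open>The local resolvent of the subdifferential\<close>

text \<open>
  Fermat's rule for an interior minimizer of \<open>g(\<cdot>, p)\<close> plus a quadratic function.
\<close>

lemma minimizer_subgradient:
  assumes \<eta>: "\<eta> < a" and p: "p \<in> ball pb a" and x: "norm (x - xb) < \<eta>" and t: "g x p = ereal t"
    and min: "\<And>u t'. \<lbrakk>u \<in> cball xb \<eta>; g u p = ereal t'\<rbrakk>
      \<Longrightarrow> t - z \<bullet> (x - xb) + s / 2 * (norm (x - xb))\<^sup>2 + \<mu> * (norm (x - y))\<^sup>2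
        \<le> t' - z \<bullet> (u - xb) + s / 2 * (norm (u - xb))\<^sup>2 + \<mu> * (norm (u - y))\<^sup>2"
  shows "z - s *\<^sub>R (x - xb) - (2 * \<mu>) *\<^sub>R (x - y) \<in> partial_subdiff g x p"
    (is "?w \<in> _")
  unfolding partial_subdiff_def
proof (rule proximal_subgradient_limiting)
  show "\<bar>g x p\<bar> \<noteq> \<infinity>" by (simp add: t)
  show "\<eta> - norm (x - xb) > 0" using x by simp
  fix u assume "u \<in> ball x (\<eta> - norm (x - xb))"
  then have u: "u \<in> cball xb \<eta>"
    using dist_triangle[of xb u x] by (simp add: dist_norm norm_minus_commute)
  then have ua: "u \<in> ball xb a" using \<eta> by simp
  show "g x p + ereal (?w \<bullet> (u - x) - (s / 2 + \<mu>) * (norm (u - x))\<^sup>2) \<le> g u p"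
  proof (cases "g u p")
    case (real t')
    have sq: "(norm (u - v))\<^sup>2 = (norm (x - v))\<^sup>2 + 2 * ((x - v) \<bullet> (u - x)) + (norm (u - x))\<^sup>2" for v
      using dot_norm[of "x - v" "u - x"] by (simp add: field_simps)
    have "t + (z \<bullet> (u - x) - s * ((x - xb) \<bullet> (u - x)) - 2 * \<mu> * ((x - y) \<bullet> (u - x))
        - (s / 2 + \<mu>) * (norm (u - x))\<^sup>2) \<le> t'"
    proof -
      have "z \<bullet> (u - xb) = z \<bullet> (x - xb) + z \<bullet> (u - x)" by (simp add: inner_diff_right)
      with min[OF u real] show ?thesis unfolding sq[of xb] sq[of y] by (simp add: algebra_simps)
    qed
    then show ?thesis by (simp add: t real inner_diff_left)
  qed (use value_lower[OF ua p] in auto)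
qed

text \<open>
  The objective satisfies the closedness assumption of the variational principle.
\<close>

lemma closed_tilted_epigraph:
  assumes p: "p \<in> ball pb a" and \<eta>: "\<eta> < a"
  defines "D \<equiv> {x \<in> cball xb \<eta>. g x p \<noteq> \<infinity>}"
  shows "closed (epigraph D (\<lambda>x. real_of_ereal (g x p) - z \<bullet> (x - xb) + s / 2 * (norm (x - xb))\<^sup>2))"
proof -
  let ?T = "\<lambda>(x, t). (x, t + z \<bullet> (x - xb) - s / 2 * (norm (x - xb))\<^sup>2)"
  have "epigraph D (\<lambda>x. real_of_ereal (g x p) - z \<bullet> (x - xb) + s / 2 * (norm (x - xb))\<^sup>2)
      = (cball xb \<eta> \<times> UNIV) \<inter> ?T -` epi (\<lambda>x. g x p)"
  proof (rule set_eqI, clarify)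
    fix x t
    show "(x, t) \<in> epigraph D (\<lambda>x. real_of_ereal (g x p) - z \<bullet> (x - xb) + s / 2 * (norm (x - xb))\<^sup>2)
      \<longleftrightarrow> (x, t) \<in> (cball xb \<eta> \<times> UNIV) \<inter> ?T -` epi (\<lambda>x. g x p)"
    proof (cases "x \<in> cball xb \<eta>")
      case True
      then have "ereal (G - c) < g x p" using \<eta> by (intro value_lower p) auto
      then show ?thesis using True
        by (cases "g x p") (auto simp: epigraph_def epi_def D_def)
    qed (simp add: epigraph_def D_def)
  qed
  moreover have "closed (?T -` epi (\<lambda>x. g x p))"
    by (rule closed_vimage[OF closed_epi[OF p]]) (auto simp: split_beta intro!: continuous_intros)
  ultimately show ?thesis by (auto intro!: closed_Int closed_Times)
qed

text \<open>
  An approximate solution of \<open>z \<in> \<partial>\<^sub>xg(x, p) + s (x - xb)\<close>, from the variational principle with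
  parameter \<open>\<mu>\<close> applied to the potential \<open>h\<close> of this inclusion on \<open>cball xb \<eta>\<close>.  The lower
  bound grows like \<open>(s - r)/2 \<parallel>x - xb\<parallel>\<^sup>2\<close>, and some point near \<open>xb\<close> has a value of almost \<open>G\<close>; so
  the perturbed minimizer \<open>x\<close> satisfies \<open>\<parallel>x - xb\<parallel> \<le> \<rho>\<close> and is interior.  The four error sources
  are allowed \<open>E/4\<close> each, where \<open>E = (s - r)/2 \<rho>\<^sup>2\<close>: the lower bound, the tilt \<open>z - vh\<close>, the
  competitor \<open>x0\<close> and the perturbation.  The neighbourhood \<open>b\<close> does not depend on the accuracy
  \<open>\<delta>\<close>, which enters through \<open>\<mu>\<close> alone.
\<close>

lemma approximate_resolvent:
  assumes s: "s > r" and e: "e > 0"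
  obtains b where "0 < b" "b \<le> a"
    "\<And>p z \<delta>. \<lbrakk>p \<in> ball pb b; z \<in> ball vh b; \<delta> > 0\<rbrakk>
      \<Longrightarrow> \<exists>x w. (x, p, w) \<in> local_graph e \<and> norm (w + s *\<^sub>R (x - xb) - z) < \<delta>"
proof -
  define \<eta> where "\<eta> = min (a / 3) (c / (norm vh + 1))"
  have nv: "norm vh + 1 > 0" by (simp add: add_nonneg_pos)
  have \<eta>: "0 < \<eta>" "2 * \<eta> < a"
    using pos nv by (auto simp: \<eta>_def min_def)
  have "\<eta> \<le> c / (norm vh + 1)" by (simp add: \<eta>_def)
  then have "\<eta> * (norm vh + 1) \<le> c" using nv by (simp add: pos_le_divide_eq)
  then have \<eta>v: "norm vh * \<eta> \<le> c" using \<eta> by (simp add: algebra_simps)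
  have s0: "s > 0" using s pos by simp
  define \<rho> where "\<rho> = min (\<eta> / 2) (min (e / 2) (e / (4 * s)))"
  have \<rho>: "0 < \<rho>" "\<rho> < \<eta>" "\<rho> < e" using \<eta> e s0 by (auto simp: \<rho>_def min_def)
  have "\<rho> \<le> e / (4 * s)" by (simp add: \<rho>_def)
  then have s\<rho>: "s * \<rho> \<le> e / 4" using s0 by (simp add: field_simps)
  define E where "E = (s - r) / 2 * \<rho>\<^sup>2"
  have E: "E > 0" using s \<rho> by (simp add: E_def)
  define K where "K = norm vh + 2 + s / 2"
  have K: "K > 0" using s0 by (simp add: K_def add_nonneg_pos)
  define \<tau> where "\<tau> = min 1 (min \<eta> (E / (4 * K)))"
  have \<tau>: "0 < \<tau>" "\<tau> \<le> 1" "\<tau> \<le> \<eta>" using \<eta> E K by (auto simp: \<tau>_def)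
  have "\<tau> \<le> E / (4 * K)" by (simp add: \<tau>_def)
  then have K\<tau>: "K * \<tau> \<le> E / 4" using K by (simp add: field_simps)
  have "E / 4 > 0" using E by simp
  from perturbed_lower_bound[OF \<eta> \<eta>v this]
  obtain b1 where b1: "0 < b1" "b1 \<le> a" and low: "\<And>p x. \<lbrakk>p \<in> ball pb b1; x \<in> cball xb \<eta>\<rbrakk>
      \<Longrightarrow> ereal (G + vh \<bullet> (x - xb) - r / 2 * (norm (x - xb))\<^sup>2 - E / 4) \<le> g x p" by blast
  obtain b2 where b2: "0 < b2" "b2 \<le> a"
    and near: "\<And>p. p \<in> ball pb b2 \<Longrightarrow> \<exists>x\<in>cball xb \<tau>. g x p \<le> ereal (G + \<tau>)"
    using perturbed_point[OF \<tau>(1)] by blast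
  define b where "b = min b1 (min b2 (min 1 (min (e / 4) (E / (4 * \<eta>)))))"
  have b: "0 < b" "b \<le> b1" "b \<le> b2" "b \<le> 1" "b \<le> e / 4"
    using b1 b2 e E \<eta> by (auto simp: b_def)
  have "b \<le> E / (4 * \<eta>)" by (simp add: b_def)
  then have b\<eta>: "b * \<eta> \<le> E / 4" using \<eta> by (simp add: field_simps)
  show thesis
  proof (rule that[of b])
    show "0 < b" "b \<le> a" using b b1 by auto
    fix p z and \<delta> :: real
    assume p: "p \<in> ball pb b" and z: "z \<in> ball vh b" and \<delta>: "\<delta> > 0"
    have pa: "p \<in> ball pb a" and p1: "p \<in> ball pb b1" and p2: "p \<in> ball pb b2" using p b b1 by auto
    have zv: "norm (z - vh) < b" using z by (simp add: dist_norm norm_minus_commute)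
    define \<mu> where "\<mu> = min (E / (16 * \<eta>\<^sup>2)) (min (e / (16 * \<eta>)) (\<delta> / (8 * \<eta>)))"
    have \<mu>: "\<mu> > 0" using E e \<delta> \<eta> by (simp add: \<mu>_def)
    have "\<mu> \<le> E / (16 * \<eta>\<^sup>2)" "\<mu> \<le> e / (16 * \<eta>)" "\<mu> \<le> \<delta> / (8 * \<eta>)" by (auto simp: \<mu>_def)
    then have \<mu>s: "4 * \<mu> * \<eta>\<^sup>2 \<le> E / 4" "4 * \<mu> * \<eta> \<le> e / 4" "4 * \<mu> * \<eta> \<le> \<delta> / 2"
      using \<eta> by (simp_all add: field_simps)
    let ?D = "{x \<in> cball xb \<eta>. g x p \<noteq> \<infinity>}"
    let ?h = "\<lambda>x. real_of_ereal (g x p) - z \<bullet> (x - xb) + s / 2 * (norm (x - xb))\<^sup>2"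
    have hlow: "G + (s - r) / 2 * (norm (x - xb))\<^sup>2 - E / 2 \<le> ?h x" if x: "x \<in> ?D" for x
    proof -
      have nx: "norm (x - xb) \<le> \<eta>" using x by (simp add: dist_norm norm_minus_commute)
      have "G + vh \<bullet> (x - xb) - r / 2 * (norm (x - xb))\<^sup>2 - E / 4 \<le> real_of_ereal (g x p)"
        using low[OF p1, of x] x by (cases "g x p") auto
      moreover have "(z - vh) \<bullet> (x - xb) \<le> E / 4"
      proof -
        have "(z - vh) \<bullet> (x - xb) \<le> norm (z - vh) * norm (x - xb)" by (rule norm_cauchy_schwarz)
        also have "\<dots> \<le> b * \<eta>" using zv nx b by (intro mult_mono) auto
        finally show ?thesis using b\<eta> by simp
      qed
      ultimately show ?thesis by (simp add: inner_diff_left algebra_simps diff_divide_distrib)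
    qed
    obtain x0 where x0: "x0 \<in> cball xb \<tau>" "g x0 p \<le> ereal (G + \<tau>)" using near[OF p2] by blast
    have x0D: "x0 \<in> ?D" using x0 \<tau> by auto
    have h0: "?h x0 \<le> G + E / 4"
    proof -
      have nx: "norm (x0 - xb) \<le> \<tau>" using x0 by (simp add: dist_norm norm_minus_commute)
      have x0a: "x0 \<in> ball xb a" using x0 \<tau> \<eta> by simp
      have "real_of_ereal (g x0 p) \<le> G + \<tau>"
        using x0(2) value_lower[OF x0a pa] by (cases "g x0 p") auto
      moreover have "- (z \<bullet> (x0 - xb)) \<le> (norm vh + 1) * \<tau>"
      proof -
        have "norm z \<le> norm vh + 1" using norm_triangle_ineq[of "z - vh" vh] zv b by simp
        then have "norm z * norm (x0 - xb) \<le> (norm vh + 1) * \<tau>"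
          using nx by (intro mult_mono) auto
        then show ?thesis using Cauchy_Schwarz_ineq2[of z "x0 - xb"] by simp
      qed
      moreover have "s / 2 * (norm (x0 - xb))\<^sup>2 \<le> s / 2 * \<tau>"
      proof -
        have "(norm (x0 - xb))\<^sup>2 \<le> \<tau>\<^sup>2" using nx by (intro power_mono) auto
        also have "\<dots> \<le> \<tau>" using \<tau> by (simp add: power2_eq_square mult_left_le)
        finally show ?thesis using s0 by (intro mult_left_mono) auto
      qed
      ultimately have "?h x0 \<le> G + K * \<tau>" by (simp add: K_def algebra_simps)
      then show ?thesis using K\<tau> by simp
    qed
    have "bdd_below (?h ` ?D)"
    proof (rule bdd_belowI2)
      fix x assume "x \<in> ?D"
      moreover have "0 \<le> (s - r) / 2 * (norm (x - xb))\<^sup>2" using s by simp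
      ultimately show "G - E / 2 \<le> ?h x" using hlow[of x] by linarith
    qed
    moreover have "\<eta> < a" using \<eta> by simp
    ultimately obtain x y where x: "x \<in> ?D" and y: "y \<in> cball xb \<eta>"
      and min: "\<And>u. u \<in> ?D \<Longrightarrow> ?h x + \<mu> * (norm (x - y))\<^sup>2 \<le> ?h u + \<mu> * (norm (u - y))\<^sup>2"
      using smooth_variational_principle[of ?D xb \<eta> ?h \<mu>] x0D \<mu>
        closed_tilted_epigraph[OF pa, of \<eta> z s] by blast
    have dia: "norm (u - y) \<le> 2 * \<eta>" if "u \<in> cball xb \<eta>" for u
      using dist_triangle[of u y xb] that y by (simp add: dist_norm norm_minus_commute)
    have "\<mu> * (norm (x0 - y))\<^sup>2 \<le> \<mu> * (2 * \<eta>)\<^sup>2"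
      using dia[of x0] x0D \<mu> by (intro mult_left_mono power_mono) auto
    also have "\<dots> \<le> E / 4" using \<mu>s(1) by (simp add: power_mult_distrib)
    finally have "\<mu> * (norm (x0 - y))\<^sup>2 \<le> E / 4" .
    moreover have "0 \<le> \<mu> * (norm (x - y))\<^sup>2" using \<mu> by simp
    ultimately have "(s - r) / 2 * (norm (x - xb))\<^sup>2 \<le> E"
      using hlow[OF x] h0 min[OF x0D] by linarith
    then have "(norm (x - xb))\<^sup>2 \<le> \<rho>\<^sup>2" using s by (simp add: E_def)
    then have nx: "norm (x - xb) \<le> \<rho>" by (rule power2_le_imp_le) (use \<rho> in simp)
    have xa: "x \<in> ball xb a" using x \<eta> by auto
    obtain t where t: "g x p = ereal t" using x value_lower[OF xa pa] by (cases "g x p") auto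
    let ?w = "z - s *\<^sub>R (x - xb) - (2 * \<mu>) *\<^sub>R (x - y)"
    have sub: "?w \<in> partial_subdiff g x p"
    proof (rule minimizer_subgradient[of \<eta>, OF _ pa _ t])
      show "\<eta> < a" "norm (x - xb) < \<eta>" using \<eta> nx \<rho> by auto
      fix u t' assume "u \<in> cball xb \<eta>" "g u p = ereal t'"
      then show "t - z \<bullet> (x - xb) + s / 2 * (norm (x - xb))\<^sup>2 + \<mu> * (norm (x - y))\<^sup>2
        \<le> t' - z \<bullet> (u - xb) + s / 2 * (norm (u - xb))\<^sup>2 + \<mu> * (norm (u - y))\<^sup>2"
        using min[of u] t by simp
    qed
    have small: "norm ((2 * \<mu>) *\<^sub>R (x - y)) \<le> 4 * \<mu> * \<eta>"
      using dia[of x] x \<mu> by simp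
    have "norm (?w - vh) \<le> norm (z - vh) + norm (s *\<^sub>R (x - xb)) + norm ((2 * \<mu>) *\<^sub>R (x - y))"
      using norm_triangle_ineq4[of "z - vh - s *\<^sub>R (x - xb)" "(2 * \<mu>) *\<^sub>R (x - y)"]
        norm_triangle_ineq4[of "z - vh" "s *\<^sub>R (x - xb)"] by (simp add: algebra_simps)
    also have "norm (s *\<^sub>R (x - xb)) \<le> s * \<rho>" using nx s0 by simp
    finally have "norm (?w - vh) < e" using zv b(5) s\<rho> small \<mu>s(2) e by linarith
    moreover have "p \<in> ball pb e" using p b e by simp
    moreover have "x \<in> ball xb e" using nx \<rho> by (simp add: dist_norm norm_minus_commute)
    ultimately have "(x, p, ?w) \<in> local_graph e"
      using sub by (simp add: local_graph_def dist_norm norm_minus_commute)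
    moreover have "norm (?w + s *\<^sub>R (x - xb) - z) < \<delta>"
      using small \<mu>s(3) \<delta> by (simp add: norm_minus_commute)
    ultimately show "\<exists>x w. (x, p, w) \<in> local_graph e \<and> norm (w + s *\<^sub>R (x - xb) - z) < \<delta>" by blast
  qed
qed

text \<open>
  Two approximate solutions for the same \<open>(p, z)\<close> differ by at most the sum of their errors divided
  by \<open>s - r\<close>; so approximate solutions with errors tending to 0 converge.
\<close>

lemma resolvent:
  assumes s: "s > r" and e: "e > 0"
  obtains b where "0 < b" "b \<le> a"
    "\<And>p z. \<lbrakk>p \<in> ball pb b; z \<in> ball vh b\<rbrakk> \<Longrightarrow> \<exists>x. (x, p, z - s *\<^sub>R (x - xb)) \<in> local_graph e"
proof -
  obtain b0 C where b0: "0 < b0" "b0 \<le> a"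
    and hypo: "\<And>x1 p1 w1 x2 p2 w2. \<lbrakk>(x1, p1, w1) \<in> local_graph b0; (x2, p2, w2) \<in> local_graph b0\<rbrakk>
       \<Longrightarrow> - r * (norm (x1 - x2))\<^sup>2 - C * dist p1 p2 \<le> (w1 - w2) \<bullet> (x1 - x2)"
    using hypomonotone_up_to_parameter by metis
  define e' where "e' = min (e / 2) (b0 / 2)"
  have e': "0 < e'" "e' < e" "e' < b0" using e b0 by (auto simp: e'_def)
  obtain b where b: "0 < b" "b \<le> a"
    and approx: "\<And>p z \<delta>. \<lbrakk>p \<in> ball pb b; z \<in> ball vh b; \<delta> > 0\<rbrakk>
      \<Longrightarrow> \<exists>x w. (x, p, w) \<in> local_graph e' \<and> norm (w + s *\<^sub>R (x - xb) - z) < \<delta>"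
    using approximate_resolvent[OF s e'(1)] by metis
  show thesis
  proof (rule that[OF b])
    fix p z assume p: "p \<in> ball pb b" and z: "z \<in> ball vh b"
    have "\<exists>x w. (x, p, w) \<in> local_graph e' \<and> norm (w + s *\<^sub>R (x - xb) - z) < inverse (real (Suc k))" for k
      by (rule approx[OF p z]) simp
    then obtain X W where XW: "\<And>k. (X k, p, W k) \<in> local_graph e'"
      and err: "\<And>k. norm (W k + s *\<^sub>R (X k - xb) - z) < inverse (real (Suc k))" by metis
    have XWb: "(X k, p, W k) \<in> local_graph b0" for k using XW[of k] local_graph_mono[of e' b0] e' by auto
    have XWa: "(X k, p, W k) \<in> local_graph a" for k using XWb[of k] local_graph_mono[OF b0(2)] by auto
    have close: "(s - r) * norm (X j - X k) \<le> inverse (real (Suc j)) + inverse (real (Suc k))" for j k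
    proof -
      have "- r * (norm (X j - X k))\<^sup>2 \<le> (W j - W k) \<bullet> (X j - X k)"
        using hypo[OF XWb[of j] XWb[of k]] by simp
      from shifted_hypomonotone_lipschitz[OF this, of s xb]
      show ?thesis
        using norm_triangle_ineq4[of "W j + s *\<^sub>R (X j - xb) - z" "W k + s *\<^sub>R (X k - xb) - z"]
          err[of j] err[of k] by simp
    qed
    have "Cauchy X"
    proof (rule metric_CauchyI)
      fix \<epsilon> :: real assume "\<epsilon> > 0"
      then have "(s - r) * \<epsilon> / 2 > 0" using s by simp
      then obtain N where N: "inverse (real (Suc N)) < (s - r) * \<epsilon> / 2"
        using reals_Archimedean by blast
      have "dist (X j) (X k) < \<epsilon>" if "j \<ge> N" "k \<ge> N" for j k
      proof -
        have "inverse (real (Suc j)) \<le> inverse (real (Suc N))"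
          "inverse (real (Suc k)) \<le> inverse (real (Suc N))"
          using that by (auto intro!: le_imp_inverse_le)
        then have "(s - r) * norm (X j - X k) < (s - r) * \<epsilon>" using close[of j k] N by linarith
        then show ?thesis using s by (simp add: dist_norm)
      qed
      then show "\<exists>M. \<forall>m\<ge>M. \<forall>n\<ge>M. dist (X m) (X n) < \<epsilon>" by blast
    qed
    then obtain x where x: "X \<longlonglongrightarrow> x" using Cauchy_convergent convergent_def by blast
    have "(\<lambda>k. W k + s *\<^sub>R (X k - xb) - z) \<longlonglongrightarrow> 0"
      by (rule Lim_null_comparison[OF _ LIMSEQ_inverse_real_of_nat])
         (use err in \<open>auto intro!: always_eventually less_imp_le\<close>)
    then have "(\<lambda>k. (W k + s *\<^sub>R (X k - xb) - z) + (z - s *\<^sub>R (X k - xb)))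
        \<longlonglongrightarrow> 0 + (z - s *\<^sub>R (x - xb))"
      by (intro tendsto_intros x)
    then have W: "W \<longlonglongrightarrow> z - s *\<^sub>R (x - xb)" by simp
    have xc: "x \<in> cball xb e'"
      by (rule closed_sequentially[OF closed_cball _ x]) (use XW in \<open>auto simp: local_graph_def intro: less_imp_le\<close>)
    have wc: "z - s *\<^sub>R (x - xb) \<in> cball vh e'"
      by (rule closed_sequentially[OF closed_cball _ W]) (use XW in \<open>auto simp: local_graph_def intro: less_imp_le\<close>)
    have "x \<in> ball xb a" using xc e' b0 by simp
    then have "z - s *\<^sub>R (x - xb) \<in> partial_subdiff g x p"
      by (rule subgradient_limit[OF x W XWa])
    moreover have "p \<in> ball pb e" using XW[of 0] e' by (auto simp: local_graph_def)
    ultimately show "\<exists>x. (x, p, z - s *\<^sub>R (x - xb)) \<in> local_graph e"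
      using xc wc e' by (intro exI[of _ x]) (auto simp: local_graph_def)
  qed
qed

section \<open>Full stability from strong monotonicity\<close>

text \<open>
  The bound \<open>\<sigma> \<le> L\<close>, which can be reached by enlarging \<open>L\<close>, keeps \<open>s\<^sup>2 - 2 s \<sigma> + L\<^sup>2\<close> nonnegative.
\<close>

lemma hoelder_fully_stable_if_strongly_monotone:
  fixes f :: "'x \<Rightarrow> 'p \<Rightarrow> 'q::metric_space \<Rightarrow> 'x"
  assumes vh: "vh = vb - f xb pb qb" and d: "d > 0" and L: "L > 0" "\<sigma> \<le> L" and \<sigma>: "r < \<sigma>"
    and lip: "\<And>x1 x2 p1 p2 q1 q2. \<lbrakk>x1 \<in> ball xb d; x2 \<in> ball xb d; p1 \<in> ball pb d; p2 \<in> ball pb d;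
      q1 \<in> ball qb d; q2 \<in> ball qb d\<rbrakk>
      \<Longrightarrow> norm (f x1 p1 q1 - f x2 p2 q2) \<le> L * (norm (x1 - x2) + dist p1 p2 + dist q1 q2)"
    and mono: "\<And>x1 x2 p q. \<lbrakk>x1 \<in> ball xb d; x2 \<in> ball xb d; p \<in> ball pb d; q \<in> ball qb d\<rbrakk>
      \<Longrightarrow> \<sigma> * (norm (x1 - x2))\<^sup>2 \<le> (f x1 p q - f x2 p q) \<bullet> (x1 - x2)"
  shows "hoelder_fully_stable (solution_map f g) xb vb pb qb"
proof -
  obtain b0 C where b0: "0 < b0" "b0 \<le> a" and C: "0 \<le> C"
    and hypo: "\<And>x1 p1 w1 x2 p2 w2. \<lbrakk>(x1, p1, w1) \<in> local_graph b0; (x2, p2, w2) \<in> local_graph b0\<rbrakk>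
       \<Longrightarrow> - r * (norm (x1 - x2))\<^sup>2 - C * dist p1 p2 \<le> (w1 - w2) \<bullet> (x1 - x2)"
    using hypomonotone_up_to_parameter by metis
  \<comment> \<open>Large enough for \<open>s\<^sup>2 - 2 s \<sigma> + L\<^sup>2 < (s - r)\<^sup>2\<close>, i.e. \<open>L\<^sup>2 - r\<^sup>2 < 2 s (\<sigma> - r)\<close>.\<close>
  define s where "s = r + 1 + L\<^sup>2 / (2 * (\<sigma> - r))"
  have s: "r < s" "0 < s" using pos \<sigma> by (auto simp: s_def intro!: add_pos_nonneg add_less_le_mono)
  define k where "k = sqrt (s\<^sup>2 - 2 * s * \<sigma> + L\<^sup>2) / (s - r)"
  have k: "0 \<le> k" "k < 1"
  proof -
    have "\<sigma>\<^sup>2 \<le> L\<^sup>2" using L \<sigma> pos by (intro power_mono) auto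
    moreover have "0 \<le> (s - \<sigma>)\<^sup>2" by simp
    ultimately have nonneg: "0 \<le> s\<^sup>2 - 2 * s * \<sigma> + L\<^sup>2"
      by (simp add: power2_eq_square algebra_simps)
    then show "0 \<le> k" using s by (simp add: k_def)
    have "2 * (\<sigma> - r) * s = 2 * (\<sigma> - r) * (r + 1) + L\<^sup>2"
      using \<sigma> by (simp add: s_def distrib_left)
    moreover have "0 < 2 * (\<sigma> - r) * (r + 1)" using \<sigma> pos by (intro mult_pos_pos) auto
    moreover have "0 \<le> r\<^sup>2" by simp
    moreover have "(s - r)\<^sup>2 = s\<^sup>2 - 2 * s * \<sigma> + 2 * (\<sigma> - r) * s + r\<^sup>2"
      by (simp add: power2_eq_square algebra_simps)
    ultimately have "s\<^sup>2 - 2 * s * \<sigma> + L\<^sup>2 < (s - r)\<^sup>2" by linarith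
    then have "sqrt (s\<^sup>2 - 2 * s * \<sigma> + L\<^sup>2) < s - r"
      using s by (intro real_less_lsqrt) auto
    then show "k < 1" using s by (simp add: k_def)
  qed
  obtain b1 where b1: "0 < b1" "b1 \<le> a"
    and res: "\<And>p z. \<lbrakk>p \<in> ball pb b1; z \<in> ball vh b1\<rbrakk> \<Longrightarrow> \<exists>x. (x, p, z - s *\<^sub>R (x - xb)) \<in> local_graph b0"
    using resolvent[OF s(1) b0(1)] by metis
  define m where "m = min b0 b1"
  have m: "0 < m" "m \<le> b0" "m \<le> b1" using b0 b1 by (auto simp: m_def)
  \<comment> \<open>The radii \<open>\<rho>\<close> and \<open>\<beta>\<close> keep \<open>v - f x p q\<close> and the argument of the resolvent within \<open>m\<close> of \<open>vh\<close>.\<close>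
  define \<rho> where "\<rho> = min (d / 2) (min (b0 / 2) (m / (4 * (L + s))))"
  have "0 < \<rho>" using d b0 m L s by (simp add: \<rho>_def)
  moreover have "\<rho> \<le> d / 2" "\<rho> \<le> b0 / 2" unfolding \<rho>_def by linarith+
  ultimately have \<rho>: "0 < \<rho>" "\<rho> < d" "\<rho> < b0" using d b0 by auto
  have "\<rho> \<le> m / (4 * (L + s))" by (simp add: \<rho>_def)
  then have \<rho>m: "(L + s) * \<rho> \<le> m / 4" using L s by (simp add: field_simps)
  \<comment> \<open>A \<open>k\<close>-contraction that moves \<open>xb\<close> by at most \<open>(1 - k) \<rho>\<close> maps \<open>cball xb \<rho>\<close> into itself.\<close>
  define e2 where "e2 = min b0 ((1 - k) * \<rho>)"
  have e2: "0 < e2" "e2 \<le> b0" "e2 \<le> (1 - k) * \<rho>" using b0 k \<rho> by (auto simp: e2_def)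
  obtain b2 where b2: "0 < b2" "b2 \<le> a"
    and res2: "\<And>p z. \<lbrakk>p \<in> ball pb b2; z \<in> ball vh b2\<rbrakk> \<Longrightarrow> \<exists>x. (x, p, z - s *\<^sub>R (x - xb)) \<in> local_graph e2"
    using resolvent[OF s(1) e2(1)] by metis
  define \<beta> where "\<beta> = min (min d (min m b2)) (min (m / 4) b2 / (1 + 2 * L))"
  have \<beta>: "0 < \<beta>" "\<beta> \<le> d" "\<beta> \<le> m" "\<beta> \<le> b2" using d m b2 L by (auto simp: \<beta>_def)
  have "\<beta> \<le> min (m / 4) b2 / (1 + 2 * L)" by (simp add: \<beta>_def)
  then have "\<beta> * (1 + 2 * L) \<le> min (m / 4) b2" using L by (subst (asm) pos_le_divide_eq) auto
  then have \<beta>L: "\<beta> + 2 * L * \<beta> \<le> m / 4" "\<beta> + 2 * L * \<beta> \<le> b2" by (auto simp: algebra_simps)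
  let ?S = "solution_map f g"

  have residual: "norm (v - f x p q - vh) < \<beta> + L * (norm (x - xb) + 2 * \<beta>)"
    if "v \<in> ball vb \<beta>" "p \<in> ball pb \<beta>" "q \<in> ball qb \<beta>" "x \<in> cball xb \<rho>" for v p q x
  proof -
    have "norm (f x p q - f xb pb qb) \<le> L * (norm (x - xb) + dist p pb + dist q qb)"
      using that \<rho> \<beta> d by (intro lip) auto
    also have "\<dots> \<le> L * (norm (x - xb) + 2 * \<beta>)"
      using that L by (intro mult_left_mono) (auto simp: dist_commute)
    finally have "norm (f x p q - f xb pb qb) \<le> L * (norm (x - xb) + 2 * \<beta>)" .
    moreover have "v - f x p q - vh = (v - vb) - (f x p q - f xb pb qb)" by (simp add: vh)
    moreover have "norm (v - vb) < \<beta>" using that by (simp add: dist_norm norm_minus_commute)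
    ultimately show ?thesis
      using norm_triangle_ineq4[of "v - vb" "f x p q - f xb pb qb"] by (simp only:)
  qed
  have residual_bound: "norm (v - f x p q - vh) < m" "norm (v - f x p q + s *\<^sub>R (x - xb) - vh) < m"
    if A: "v \<in> ball vb \<beta>" "p \<in> ball pb \<beta>" "q \<in> ball qb \<beta>" "x \<in> cball xb \<rho>" for v p q x
  proof -
    have nx: "norm (x - xb) \<le> \<rho>" using A by (simp add: dist_norm norm_minus_commute)
    have "L * norm (x - xb) \<le> L * \<rho>" "s * norm (x - xb) \<le> s * \<rho>" "0 \<le> s * norm (x - xb)"
      using nx L s by (auto intro: mult_left_mono)
    then have *: "norm (v - f x p q - vh) + s * norm (x - xb) < m"
      using residual[OF A] \<rho>m \<beta>L m by (simp add: algebra_simps)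
    then show "norm (v - f x p q - vh) < m" using \<open>0 \<le> s * norm (x - xb)\<close> by linarith
    have "norm (v - f x p q + s *\<^sub>R (x - xb) - vh) \<le> norm (v - f x p q - vh) + s * norm (x - xb)"
    proof -
      have "v - f x p q + s *\<^sub>R (x - xb) - vh = (v - f x p q - vh) + s *\<^sub>R (x - xb)" by simp
      moreover have "norm (s *\<^sub>R (x - xb)) = s * norm (x - xb)" using s by simp
      ultimately show ?thesis
        using norm_triangle_ineq[of "v - f x p q - vh" "s *\<^sub>R (x - xb)"] by (simp only:)
    qed
    then show "norm (v - f x p q + s *\<^sub>R (x - xb) - vh) < m" using * by linarith
  qed
  have sol_iff: "x \<in> ?S (v, p, q) \<longleftrightarrow> (x, p, v - f x p q) \<in> local_graph b0"
    if A: "v \<in> ball vb \<beta>" "p \<in> ball pb \<beta>" "q \<in> ball qb \<beta>" "x \<in> cball xb \<rho>" for v p q x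
  proof -
    have "x \<in> ?S (v, p, q) \<longleftrightarrow> v - f x p q \<in> partial_subdiff g x p"
      by (auto simp: solution_map_def intro!: bexI[of _ "v - f x p q"])
    then show ?thesis
      using A residual_bound(1)[OF A] \<rho> \<beta> m by (auto simp: local_graph_def dist_norm norm_minus_commute)
  qed

  \<comment> \<open>Uniqueness and the stability estimate both come from this one inequality.\<close>
  have monotone: "(\<sigma> - r) * (norm (x1 - x2))\<^sup>2 - (C + 2 * L * \<rho>) * dist p1 p2
        - L * dist q1 q2 * norm (x1 - x2) \<le> (v1 - v2) \<bullet> (x1 - x2)"
    if A1: "v1 \<in> ball vb \<beta>" "p1 \<in> ball pb \<beta>" "q1 \<in> ball qb \<beta>" "x1 \<in> cball xb \<rho>"
      and S1: "x1 \<in> ?S (v1, p1, q1)"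
      and A2: "v2 \<in> ball vb \<beta>" "p2 \<in> ball pb \<beta>" "q2 \<in> ball qb \<beta>" "x2 \<in> cball xb \<rho>"
      and S2: "x2 \<in> ?S (v2, p2, q2)"
    for v1 p1 q1 x1 v2 p2 q2 x2
  proof -
    let ?x = "x1 - x2"
    have in_d: "x1 \<in> ball xb d" "x2 \<in> ball xb d" "p1 \<in> ball pb d" "p2 \<in> ball pb d"
      "q1 \<in> ball qb d" "q2 \<in> ball qb d" using A1 A2 \<rho> \<beta> by auto
    have nx: "norm ?x \<le> 2 * \<rho>"
      using dist_triangle[of x1 x2 xb] A1(4) A2(4) by (simp add: dist_norm norm_minus_commute)
    have hyp: "- r * (norm ?x)\<^sup>2 - C * dist p1 p2
        \<le> ((v1 - f x1 p1 q1) - (v2 - f x2 p2 q2)) \<bullet> ?x"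
      using S1 S2 sol_iff[OF A1] sol_iff[OF A2] by (intro hypo) auto
    have m1: "\<sigma> * (norm ?x)\<^sup>2 \<le> (f x1 p1 q1 - f x2 p1 q1) \<bullet> ?x"
      using in_d by (intro mono)
    have "norm (f x2 p1 q1 - f x2 p2 q2) \<le> L * (dist p1 p2 + dist q1 q2)"
      using lip[of x2 x2 p1 p2 q1 q2] in_d by simp
    then have "norm (f x2 p1 q1 - f x2 p2 q2) * norm ?x \<le> L * (dist p1 p2 + dist q1 q2) * norm ?x"
      by (intro mult_right_mono) auto
    then have "- ((f x2 p1 q1 - f x2 p2 q2) \<bullet> ?x) \<le> L * (dist p1 p2 + dist q1 q2) * norm ?x"
      using Cauchy_Schwarz_ineq2[of "f x2 p1 q1 - f x2 p2 q2" ?x] by linarith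
    also have "\<dots> = L * dist p1 p2 * norm ?x + L * dist q1 q2 * norm ?x"
      by (simp add: algebra_simps)
    also have "L * dist p1 p2 * norm ?x \<le> L * dist p1 p2 * (2 * \<rho>)"
      using nx L by (intro mult_left_mono) auto
    finally have m2: "- ((f x2 p1 q1 - f x2 p2 q2) \<bullet> ?x)
        \<le> L * dist p1 p2 * (2 * \<rho>) + L * dist q1 q2 * norm ?x" by simp
    have "((v1 - f x1 p1 q1) - (v2 - f x2 p2 q2)) \<bullet> ?x
        = (v1 - v2) \<bullet> ?x - (f x1 p1 q1 - f x2 p1 q1) \<bullet> ?x - (f x2 p1 q1 - f x2 p2 q2) \<bullet> ?x"
      unfolding inner_diff_left by simp
    with hyp m1 m2 show ?thesis by (simp add: algebra_simps)
  qed
  have unique: "x1 = x2"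
    if "v \<in> ball vb \<beta>" "p \<in> ball pb \<beta>" "q \<in> ball qb \<beta>" "x1 \<in> cball xb \<rho>" "x1 \<in> ?S (v, p, q)"
      "x2 \<in> cball xb \<rho>" "x2 \<in> ?S (v, p, q)" for v p q x1 x2
  proof -
    have "(\<sigma> - r) * (norm (x1 - x2))\<^sup>2 \<le> 0"
      using monotone[of v p q x1 v p q x2] that by simp
    then have "(norm (x1 - x2))\<^sup>2 \<le> 0" using \<sigma> by (simp add: mult_le_0_iff)
    then show ?thesis by simp
  qed

  have exists: "\<exists>x\<in>cball xb \<rho>. x \<in> ?S (v, p, q)"
    if v: "v \<in> ball vb \<beta>" and p: "p \<in> ball pb \<beta>" and q: "q \<in> ball qb \<beta>" for v p q
  proof -
    let ?z = "\<lambda>x. v - f x p q + s *\<^sub>R (x - xb)"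
    have in_d: "p \<in> ball pb d" "q \<in> ball qb d" using p q \<beta> by auto
    have "\<exists>x'. (x', p, ?z x - s *\<^sub>R (x' - xb)) \<in> local_graph b0" if "x \<in> cball xb \<rho>" for x
      using residual_bound(2)[OF v p q that] p \<beta> m
      by (intro res) (auto simp: dist_norm norm_minus_commute)
    then obtain J where J: "\<And>x. x \<in> cball xb \<rho> \<Longrightarrow> (J x, p, ?z x - s *\<^sub>R (J x - xb)) \<in> local_graph b0"
      by metis
    have lipJ: "(s - r) * norm (x1 - x2) \<le> norm (z1 - z2)"
      if "(x1, p, z1 - s *\<^sub>R (x1 - xb)) \<in> local_graph b0" "(x2, p, z2 - s *\<^sub>R (x2 - xb)) \<in> local_graph b0"
      for x1 x2 z1 z2
    proof -
      have "- r * (norm (x1 - x2))\<^sup>2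
          \<le> ((z1 - s *\<^sub>R (x1 - xb)) - (z2 - s *\<^sub>R (x2 - xb))) \<bullet> (x1 - x2)"
        using hypo[OF that] by simp
      from shifted_hypomonotone_lipschitz[OF this, of s xb] show ?thesis by simp
    qed
    have contraction: "norm (J x1 - J x2) \<le> k * norm (x1 - x2)"
      if "x1 \<in> cball xb \<rho>" "x2 \<in> cball xb \<rho>" for x1 x2
    proof -
      have x: "x1 \<in> ball xb d" "x2 \<in> ball xb d" using that \<rho> by auto
      have "(s - r) * norm (J x1 - J x2) \<le> norm (?z x1 - ?z x2)"
        by (rule lipJ[OF J J]) fact+
      also have "?z x1 - ?z x2 = s *\<^sub>R (x1 - x2) - (f x1 p q - f x2 p q)"
        by (simp add: algebra_simps)
      also have "norm \<dots> \<le> sqrt (s\<^sup>2 - 2 * s * \<sigma> + L\<^sup>2) * norm (x1 - x2)"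
        using mono[OF x in_d] lip[OF x in_d(1,1) in_d(2,2)] s
        by (intro strongly_monotone_shift_contracts) auto
      finally show ?thesis using s by (simp add: k_def field_simps)
    qed
    have xbc: "xb \<in> cball xb \<rho>" using \<rho> by simp
    have Jxb: "norm (J xb - xb) \<le> (1 - k) * \<rho>"
    proof -
      have "norm (?z xb - vh) < b2" using residual[OF v p q xbc] \<beta>L by simp
      then obtain x where x: "(x, p, ?z xb - s *\<^sub>R (x - xb)) \<in> local_graph e2"
        using res2[of p "?z xb"] p \<beta> by (auto simp: dist_norm norm_minus_commute)
      then have "(s - r) * norm (J xb - x) \<le> norm (?z xb - ?z xb)"
        using local_graph_mono[OF e2(2)] by (intro lipJ[OF J[OF xbc]]) auto
      then have "J xb = x" using s by (simp add: mult_le_0_iff)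
      then show ?thesis using x e2 by (simp add: local_graph_def dist_norm norm_minus_commute)
    qed
    have "\<exists>!x\<in>cball xb \<rho>. J x = x"
    proof (rule Banach_fix[where c = k])
      show "complete (cball xb \<rho>)" by (simp add: complete_eq_closed)
      show "cball xb \<rho> \<noteq> {}" using xbc by blast
      show "0 \<le> k" "k < 1" by fact+
      show "J ` cball xb \<rho> \<subseteq> cball xb \<rho>"
      proof (rule image_subsetI)
        fix x assume x: "x \<in> cball xb \<rho>"
        have "norm (J x - xb) \<le> norm (J x - J xb) + norm (J xb - xb)"
          using norm_triangle_ineq[of "J x - J xb" "J xb - xb"] by simp
        also have "norm (J x - J xb) \<le> k * norm (x - xb)" by (rule contraction[OF x xbc])
        also have "\<dots> \<le> k * \<rho>"
          using x k by (intro mult_left_mono) (auto simp: dist_norm norm_minus_commute)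
        finally have "norm (J x - xb) \<le> \<rho>" using Jxb by (simp add: algebra_simps)
        then show "J x \<in> cball xb \<rho>" by (simp add: dist_norm norm_minus_commute)
      qed
      show "dist (J x) (J y) \<le> k * dist x y" if "x \<in> cball xb \<rho>" "y \<in> cball xb \<rho>" for x y
        using contraction that by (simp add: dist_norm)
    qed
    then obtain x where x: "x \<in> cball xb \<rho>" "J x = x" by blast
    then have "(x, p, v - f x p q) \<in> local_graph b0" using J[OF x(1)] by simp
    then show ?thesis using sol_iff[OF v p q x(1)] x(1) by blast
  qed

  \<comment> \<open>Half of the monotonicity modulus is spent on absorbing the mixed term in \<open>hoelder_estimate\<close>.\<close>
  let ?\<kappa> = "(\<sigma> - r) / 2"
  define \<theta> where "\<theta> = (\<lambda>(v, p, q). SOME x. x \<in> cball xb \<rho> \<and> x \<in> ?S (v, p, q))"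
  have \<theta>: "\<theta> (v, p, q) \<in> cball xb \<rho> \<and> \<theta> (v, p, q) \<in> ?S (v, p, q)"
    if "v \<in> ball vb \<beta>" "p \<in> ball pb \<beta>" "q \<in> ball qb \<beta>" for v p q
    unfolding \<theta>_def prod.case by (rule someI_ex) (use exists[OF that] in blast)
  let ?A = "ball vb \<beta> \<times> ball pb \<beta> \<times> ball qb \<beta>"
  let ?l = "sqrt (4 * ?\<kappa> * (C + 2 * L * \<rho>)) + L"
  have localization: "single_valued_localization ?S ?A (cball xb \<rho>) \<theta>"
    unfolding single_valued_localization_def gph_def
  proof (intro conjI set_eqI iffI)
    show "\<theta> \<in> ?A \<rightarrow> cball xb \<rho>" using \<theta> by auto
    fix y assume "y \<in> {(m, \<theta> m) |m. m \<in> ?A}"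
    then show "y \<in> {(m, y). y \<in> ?S m} \<inter> ?A \<times> cball xb \<rho>" using \<theta> by fastforce
  next
    fix y assume "y \<in> {(m, y). y \<in> ?S m} \<inter> ?A \<times> cball xb \<rho>"
    then obtain v p q x where y: "y = ((v, p, q), x)" "v \<in> ball vb \<beta>" "p \<in> ball pb \<beta>" "q \<in> ball qb \<beta>"
      "x \<in> cball xb \<rho>" "x \<in> ?S (v, p, q)" by auto
    then have "x = \<theta> (v, p, q)" using unique \<theta> by blast
    then show "y \<in> {(m, \<theta> m) |m. m \<in> ?A}" using y by auto
  qed
  have est: "norm ((v1 - v2) - (2 * ?\<kappa>) *\<^sub>R (\<theta> (v1, p1, q1) - \<theta> (v2, p2, q2)))
      \<le> norm (v1 - v2) + ?l * (sqrt (dist p1 p2) + dist q1 q2)"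
    if 1: "v1 \<in> ball vb \<beta>" "p1 \<in> ball pb \<beta>" "q1 \<in> ball qb \<beta>"
      and 2: "v2 \<in> ball vb \<beta>" "p2 \<in> ball pb \<beta>" "q2 \<in> ball qb \<beta>" for v1 p1 q1 v2 p2 q2
  proof (rule hoelder_estimate)
    show "2 * ?\<kappa> * (norm (\<theta> (v1, p1, q1) - \<theta> (v2, p2, q2)))\<^sup>2 - (C + 2 * L * \<rho>) * dist p1 p2
        - L * dist q1 q2 * norm (\<theta> (v1, p1, q1) - \<theta> (v2, p2, q2))
      \<le> (v1 - v2) \<bullet> (\<theta> (v1, p1, q1) - \<theta> (v2, p2, q2))"
    proof -
      have "2 * ?\<kappa> = \<sigma> - r" by simp
      then show ?thesis using \<theta>[OF 1] \<theta>[OF 2] by (simp only:) (intro monotone 1 2, auto)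
    qed
  qed (use \<sigma> C L \<rho> in auto)
  have base_sol: "((vb, pb, qb), xb) \<in> gph ?S"
    using base_subgradient by (auto simp: gph_def solution_map_def vh intro!: bexI)
  have "xb \<in> interior (cball xb \<rho>)"
    using \<rho>(1) by (intro interiorI[of "ball xb \<rho>"]) auto
  moreover have "vb \<in> interior (ball vb \<beta>)" "pb \<in> interior (ball pb \<beta>)" "qb \<in> interior (ball qb \<beta>)"
    using \<beta>(1) by (simp_all add: interior_open)
  moreover have "?\<kappa> > 0" using \<sigma> by simp
  moreover have "?l > 0" using \<sigma> C L \<rho> by (intro add_nonneg_pos) auto
  ultimately show ?thesis
    unfolding hoelder_fully_stable_def using base_sol localization est by blast
qed

end

section \<open>Reduction of the neighbourhood assumptions to balls\<close>

lemma lower_semicontinuous_eventually: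
  assumes "lower_semicontinuous \<phi>" and "K < \<phi> z"
  shows "\<forall>\<^sub>F y in nhds z. K < \<phi> y"
proof -
  have "\<phi> z \<le> Liminf (at z) \<phi>" using assms(1) by (simp add: lower_semicontinuous_def)
  then have "\<forall>\<^sub>F y in at z. K < \<phi> y" using assms(2) by (simp add: le_Liminf_iff)
  then show ?thesis unfolding eventually_at_filter
  proof (rule eventually_mono)
    show "K < \<phi> y" if "y \<noteq> z \<longrightarrow> y \<in> UNIV \<longrightarrow> K < \<phi> y" for y
      using that assms(2) by (cases "y = z") auto
  qed
qed

lemma closed_epi_slice:
  fixes g :: "'x::metric_space \<Rightarrow> 'p::metric_space \<Rightarrow> ereal"
  assumes lsc: "lower_semicontinuous (\<lambda>(x, p). g x p)"
  shows "closed (epi (\<lambda>x. g x p))"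
  unfolding closed_sequential_limits
proof (intro allI impI)
  fix Z :: "nat \<Rightarrow> 'x \<times> real" and z
  assume "(\<forall>n. Z n \<in> epi (\<lambda>x. g x p)) \<and> Z \<longlonglongrightarrow> z"
  then have mem: "\<And>n. Z n \<in> epi (\<lambda>x. g x p)" and lim: "Z \<longlonglongrightarrow> z" by auto
  obtain x t where z: "z = (x, t)" by (cases z)
  have limx: "(\<lambda>n. (fst (Z n), p)) \<longlonglongrightarrow> (x, p)" and limt: "(\<lambda>n. snd (Z n)) \<longlonglongrightarrow> t"
    using tendsto_fst[OF lim] tendsto_snd[OF lim] by (auto simp: z intro: tendsto_Pair)
  have "g x p \<le> ereal t"
  proof (rule ccontr)
    assume "\<not> g x p \<le> ereal t"
    then have "ereal t < g x p" by simp
    then obtain K where K: "t < K" "ereal K < g x p"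
      using ereal_dense2[of "ereal t" "g x p"] by auto
    have "\<forall>\<^sub>F n in sequentially. ereal K < g (fst (Z n)) p"
      using filterlim_iff[THEN iffD1, OF limx, rule_format,
          OF lower_semicontinuous_eventually[OF lsc, of "ereal K" "(x, p)"]] K(2) by simp
    then have "\<forall>\<^sub>F n in sequentially. K \<le> snd (Z n)"
    proof eventually_elim
      case (elim n)
      have "g (fst (Z n)) p \<le> ereal (snd (Z n))" using mem[of n] by (auto simp: epi_def split_beta)
      with elim have "ereal K < ereal (snd (Z n))" by (rule less_le_trans)
      then show ?case by simp
    qed
    then have "K \<le> t" by (rule tendsto_lowerbound[OF limt]) simp
    with K show False by simp
  qed
  then show "z \<in> epi (\<lambda>x. g x p)" by (simp add: z epi_def)
qed

lemma ball_times_ball_subset: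
  assumes "open S" "(x, y) \<in> S"
  obtains d where "d > 0" "ball x d \<times> ball y d \<subseteq> S"
proof -
  obtain A B where AB: "open A" "x \<in> A" "open B" "y \<in> B" "A \<times> B \<subseteq> S"
    using open_prod_elim[OF assms] by (metis mem_Sigma_iff)
  obtain d1 d2 where "d1 > 0" "ball x d1 \<subseteq> A" "d2 > 0" "ball y d2 \<subseteq> B"
    using AB by (meson openE)
  then show thesis using AB(5) by (intro that[of "min d1 d2"]) (auto simp: subset_iff)
qed

lemma interior_ball:
  fixes x :: "'a::metric_space"
  assumes "x \<in> interior S"
  obtains d where "d > 0" "ball x d \<subseteq> S"
  using assms by (auto simp: mem_interior)

lemma lipschitz_like_epi:
  fixes \<Phi> :: "'p::metric_space \<Rightarrow> ('x::real_normed_vector \<Rightarrow> ereal)"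
  assumes "lipschitz_like (\<lambda>p. epi (\<Phi> p)) pb (xb, G)"
  obtains l d where "l > 0" "d > 0"
    "\<And>p p' x t. \<lbrakk>p \<in> ball pb d; p' \<in> ball pb d; x \<in> ball xb d; \<bar>t - G\<bar> < d; \<Phi> p x \<le> ereal t\<rbrakk>
      \<Longrightarrow> \<exists>x'. norm (x' - x) \<le> l * dist p p' \<and> \<Phi> p' x' \<le> ereal (t + l * dist p p')"
proof -
  obtain l U V where l: "l > 0" and U: "pb \<in> interior U" and V: "(xb, G) \<in> interior V"
    and incl: "\<And>m m'. \<lbrakk>m \<in> U; m' \<in> U\<rbrakk> \<Longrightarrow> epi (\<Phi> m) \<inter> V
        \<subseteq> {y + (l * dist m m') *\<^sub>R b |y b. y \<in> epi (\<Phi> m') \<and> b \<in> cball 0 1}"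
    using assms unfolding lipschitz_like_def by blast
  obtain d1 where d1: "d1 > 0" "ball pb d1 \<subseteq> U" using interior_ball[OF U] .
  obtain d2 where d2: "d2 > 0" "ball xb d2 \<times> ball G d2 \<subseteq> interior V"
    using ball_times_ball_subset[OF open_interior V] .
  show thesis
  proof (rule that[OF l])
    show "min d1 d2 > 0" using d1 d2 by simp
    fix p p' x t
    assume *: "p \<in> ball pb (min d1 d2)" "p' \<in> ball pb (min d1 d2)" "x \<in> ball xb (min d1 d2)"
      "\<bar>t - G\<bar> < min d1 d2" "\<Phi> p x \<le> ereal t"
    then have "(x, t) \<in> ball xb d2 \<times> ball G d2" by (auto simp: dist_real_def)
    then have "(x, t) \<in> V" using d2(2) interior_subset[of V] by blast
    then have "(x, t) \<in> epi (\<Phi> p) \<inter> V" using *(5) by (simp add: epi_def)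
    moreover have "p \<in> U" "p' \<in> U" using * d1 by auto
    ultimately obtain y b where yb: "(x, t) = y + (l * dist p p') *\<^sub>R b" "y \<in> epi (\<Phi> p')" "norm b \<le> 1"
      using incl[of p p'] by fastforce
    have small: "(l * dist p p') * \<beta> \<le> l * dist p p'" if "\<beta> \<le> 1" for \<beta>
      using that l by (intro mult_left_le) auto
    have nb: "norm (fst b) \<le> 1" "\<bar>snd b\<bar> \<le> 1"
      using norm_fst_le[of "fst b" "snd b"] norm_snd_le[of "snd b" "fst b"] yb(3) by auto
    have eq: "x = fst y + (l * dist p p') *\<^sub>R fst b" "t = snd y + (l * dist p p') * snd b"
      using arg_cong[OF yb(1), of fst] arg_cong[OF yb(1), of snd] by auto
    have "norm (fst y - x) \<le> l * dist p p'" using small[OF nb(1)] l by (simp add: eq(1))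
    moreover have "snd y \<le> t + l * dist p p'" using small[of "- snd b"] nb(2) eq(2) by simp linarith
    then have "\<Phi> p' (fst y) \<le> ereal (t + l * dist p p')"
      using yb(2) by (auto simp: epi_def split_beta intro: order_trans)
    ultimately show "\<exists>x'. norm (x' - x) \<le> l * dist p p' \<and> \<Phi> p' x' \<le> ereal (t + l * dist p p')" by blast
  qed
qed

lemma locally_lipschitz_at_ball:
  assumes "locally_lipschitz_at f xb pb qb"
  obtains L d where "L > 0" "d > 0"
    "\<And>x1 x2 p1 p2 q1 q2. \<lbrakk>x1 \<in> ball xb d; x2 \<in> ball xb d; p1 \<in> ball pb d; p2 \<in> ball pb d;
      q1 \<in> ball qb d; q2 \<in> ball qb d\<rbrakk>
      \<Longrightarrow> norm (f x1 p1 q1 - f x2 p2 q2) \<le> L * (norm (x1 - x2) + dist p1 p2 + dist q1 q2)"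
proof -
  obtain L U P Q where L: "L > 0" and nb: "xb \<in> interior U" "pb \<in> interior P" "qb \<in> interior Q"
    and lip: "\<forall>x1\<in>U. \<forall>x2\<in>U. \<forall>p1\<in>P. \<forall>p2\<in>P. \<forall>q1\<in>Q. \<forall>q2\<in>Q.
           norm (f x1 p1 q1 - f x2 p2 q2) \<le> L * (norm (x1 - x2) + dist p1 p2 + dist q1 q2)"
    using assms unfolding locally_lipschitz_at_def by blast
  obtain d1 d2 d3 where "d1 > 0" "ball xb d1 \<subseteq> U" "d2 > 0" "ball pb d2 \<subseteq> P" "d3 > 0" "ball qb d3 \<subseteq> Q"
    using nb by (meson interior_ball)
  then show thesis using lip L by (intro that[of L "min d1 (min d2 d3)"]) (auto simp: subset_iff)
qed

lemma locally_strongly_monotone_ball: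
  assumes "locally_strongly_monotone f xb pb qb \<sigma>"
  obtains d where "d > 0"
    "\<And>x1 x2 p q. \<lbrakk>x1 \<in> ball xb d; x2 \<in> ball xb d; p \<in> ball pb d; q \<in> ball qb d\<rbrakk>
      \<Longrightarrow> \<sigma> * (norm (x1 - x2))\<^sup>2 \<le> (f x1 p q - f x2 p q) \<bullet> (x1 - x2)"
proof -
  obtain U P Q where nb: "xb \<in> interior U" "pb \<in> interior P" "qb \<in> interior Q"
    and mono: "\<forall>x1\<in>U. \<forall>x2\<in>U. \<forall>p\<in>P. \<forall>q\<in>Q.
           (f x1 p q - f x2 p q) \<bullet> (x1 - x2) \<ge> \<sigma> * (norm (x1 - x2))\<^sup>2"
    using assms unfolding locally_strongly_monotone_def by blast
  obtain d1 d2 d3 where "d1 > 0" "ball xb d1 \<subseteq> U" "d2 > 0" "ball pb d2 \<subseteq> P" "d3 > 0" "ball qb d3 \<subseteq> Q"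
    using nb by (meson interior_ball)
  then show thesis using mono by (intro that[of "min d1 (min d2 d3)"]) (auto simp: subset_iff)
qed

text \<open>
  Continuity of \<open>g\<close> relative to the graph of the subdifferential bounds the values of \<open>g\<close> at nearby
  points of the graph from above; this makes the restriction
  \<open>g(u, p) \<le> g(xb, pb) + \<epsilon>\<close> in prox-regularity automatic.  Joint lower semicontinuity bounds \<open>g\<close> from
  below at all nearby points.
\<close>

lemma prox_regular_data_exists:
  fixes g :: "'x::{real_inner, complete_space} \<Rightarrow> 'p::metric_space \<Rightarrow> ereal"
  assumes lsc: "lower_semicontinuous (\<lambda>(x, p). g x p)"
    and base: "vh \<in> partial_subdiff g xb pb"
    and r: "r > 0" "prox_regular_with g xb pb vh r"
    and cont: "continuous (at (xb, pb, vh) within gph_partial_subdiff g) (\<lambda>(x, p, v). g x p)"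
    and lip: "lipschitz_like (\<lambda>p. epi (\<lambda>x. g x p)) pb (xb, real_of_ereal (g xb pb))"
  obtains G l a c where "prox_regular_data g xb vh pb G r l a c"
proof -
  have "\<bar>g xb pb\<bar> \<noteq> \<infinity>"
    using base by (simp add: partial_subdiff_def limiting_subdiff_def)
  then obtain G where G: "g xb pb = ereal G" by (cases "g xb pb") auto
  obtain l d where l: "l > 0" and d: "d > 0"
    and epi: "\<And>p p' x t. \<lbrakk>p \<in> ball pb d; p' \<in> ball pb d; x \<in> ball xb d; \<bar>t - G\<bar> < d; g x p \<le> ereal t\<rbrakk>
      \<Longrightarrow> \<exists>x'. norm (x' - x) \<le> l * dist p p' \<and> g x' p' \<le> ereal (t + l * dist p p')"
    using lipschitz_like_epi[where \<Phi> = "\<lambda>p x. g x p", OF lip[unfolded G real_of_ereal.simps]] by metis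
  obtain U V P \<epsilon> where \<epsilon>: "\<epsilon> > 0"
    and nb: "xb \<in> interior U" "vh \<in> interior V" "pb \<in> interior P"
    and prox: "\<And>u p v x. \<lbrakk>u \<in> U; p \<in> P; v \<in> partial_subdiff g u p; v \<in> V;
       g u p \<le> ereal (G + \<epsilon>); x \<in> U\<rbrakk>
       \<Longrightarrow> g u p + ereal (v \<bullet> (x - u) - r / 2 * (norm (x - u))\<^sup>2) \<le> g x p"
    using r(2) unfolding prox_regular_with_def G plus_ereal.simps by blast
  obtain d1 d2 d3 where d123: "d1 > 0" "ball xb d1 \<subseteq> U" "d2 > 0" "ball vh d2 \<subseteq> V"
    "d3 > 0" "ball pb d3 \<subseteq> P"
    using nb by (meson interior_ball)
  let ?c = "min d \<epsilon>"
  have c: "?c > 0" using d \<epsilon> by simp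
  have "\<forall>\<^sub>F z in nhds (xb, pb). ereal (G - ?c) < (case z of (x, p) \<Rightarrow> g x p)"
    by (rule lower_semicontinuous_eventually[OF lsc]) (use c in \<open>simp add: G\<close>)
  then obtain S where S: "open S" "(xb, pb) \<in> S" and Slow': "\<forall>z\<in>S. ereal (G - ?c) < (case z of (x, p) \<Rightarrow> g x p)"
    unfolding eventually_nhds by meson
  have Slow: "ereal (G - ?c) < g x p" if "(x, p) \<in> S" for x p using bspec[OF Slow' that] by simp
  obtain d4 where d4: "d4 > 0" "ball xb d4 \<times> ball pb d4 \<subseteq> S"
    using ball_times_ball_subset[OF S] .
  have "\<forall>\<^sub>F z in at (xb, pb, vh) within gph_partial_subdiff g. (case z of (x, p, v) \<Rightarrow> g x p) < ereal (G + ?c)"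
    using cont unfolding continuous_within
    by (rule order_tendstoD(2)) (use c in \<open>simp add: G\<close>)
  then obtain T where T: "open T" "(xb, pb, vh) \<in> T"
    and Tup': "\<forall>z\<in>T. z \<noteq> (xb, pb, vh) \<longrightarrow> z \<in> gph_partial_subdiff g
      \<longrightarrow> (case z of (x, p, v) \<Rightarrow> g x p) < ereal (G + ?c)"
    unfolding eventually_at_topological by meson
  have Tup: "g x p < ereal (G + ?c)"
    if "(x, p, v) \<in> T" "(x, p, v) \<noteq> (xb, pb, vh)" "v \<in> partial_subdiff g x p" for x p v
    using bspec[OF Tup' that(1)] that(2,3) by (simp add: gph_partial_subdiff_def)
  obtain d5 where d5: "d5 > 0" "ball xb d5 \<times> ball (pb, vh) d5 \<subseteq> T"
    using ball_times_ball_subset[OF T] .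
  obtain d6 where d6: "d6 > 0" "ball pb d6 \<times> ball vh d6 \<subseteq> ball (pb, vh) d5"
    using ball_times_ball_subset[of "ball (pb, vh) d5" pb vh] d5 by auto
  define a where "a = min d (min (min d1 (min d2 d3)) (min d4 (min d5 d6)))"
  have "a > 0" using d d123 d4 d5 d6 by (simp add: a_def)
  moreover have "a \<le> d" "a \<le> d1" "a \<le> d2" "a \<le> d3" "a \<le> d4" "a \<le> d5" "a \<le> d6"
    unfolding a_def by linarith+
  ultimately have a: "a > 0" "a \<le> d" "a \<le> d1" "a \<le> d2" "a \<le> d3" "a \<le> d4" "a \<le> d5" "a \<le> d6" .
  have up: "g x p < ereal (G + ?c)"
    if "x \<in> ball xb a" "p \<in> ball pb a" "w \<in> ball vh a" "w \<in> partial_subdiff g x p" for x p w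
  proof (cases "(x, p, w) = (xb, pb, vh)")
    case True
    then show ?thesis using c G by simp
  next
    case False
    have "(p, w) \<in> ball (pb, vh) d5" using that a d6 by (intro subsetD[OF d6(2)]) auto
    then have "(x, p, w) \<in> T" using that a d5 by (intro subsetD[OF d5(2)]) auto
    then show ?thesis using Tup False that by blast
  qed
  have "prox_regular_data g xb vh pb G r l a ?c"
  proof
    show "a > 0" "?c > 0" "l > 0" "r > 0" "g xb pb = ereal G" "vh \<in> partial_subdiff g xb pb" by fact+
    show "closed (epi (\<lambda>x. g x p))" for p by (rule closed_epi_slice[OF lsc])
    show "ereal (G - ?c) < g x p" if "x \<in> ball xb a" "p \<in> ball pb a" for x p
      using that a by (intro Slow subsetD[OF d4(2)]) auto
    show "g x p < ereal (G + ?c)"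
      if "x \<in> ball xb a" "p \<in> ball pb a" "w \<in> ball vh a" "w \<in> partial_subdiff g x p" for x p w
      using that by (rule up)
    show "g x p + ereal (w \<bullet> (x' - x) - r / 2 * (norm (x' - x))\<^sup>2) \<le> g x' p"
      if A: "x \<in> ball xb a" "p \<in> ball pb a" "w \<in> ball vh a" "w \<in> partial_subdiff g x p"
        and x': "x' \<in> ball xb a" for x p w x'
    proof (rule prox)
      have "ereal (G + ?c) \<le> ereal (G + \<epsilon>)" by simp
      with up[OF A] show "g x p \<le> ereal (G + \<epsilon>)" by (meson less_imp_le order_trans)
      show "x \<in> U" "p \<in> P" "w \<in> V" "x' \<in> U"
        using A x' a d123 by (meson mem_ball less_le_trans subsetD)+
    qed (rule A(4))
    show "\<exists>x'. norm (x' - x) \<le> l * dist p p' \<and> g x' p' \<le> ereal (t + l * dist p p')"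
      if "p \<in> ball pb a" "p' \<in> ball pb a" "x \<in> ball xb a" "\<bar>t - G\<bar> < ?c" "g x p \<le> ereal t" for p p' x t
      using that a by (intro epi) auto
  qed
  then show thesis by (rule that)
qed

theorem theorem7p1:
  fixes f :: "'x::{real_inner, complete_space} \<Rightarrow> 'p::metric_space \<Rightarrow> 'q::metric_space \<Rightarrow> 'x"
    and g :: "'x \<Rightarrow> 'p \<Rightarrow> ereal"
    and xb vb vh :: 'x and pb :: 'p and qb :: 'q and \<sigma> :: real
  assumes g_proper: "\<And>x p. g x p \<noteq> -\<infinity>"
    and g_lsc: "lower_semicontinuous (\<lambda>(x, p). g x p)"
    and xb_sol: "xb \<in> solution_map f g (vb, pb, qb)"
    and vh: "vh = vb - f xb pb qb"
    and A1: "locally_lipschitz_at f xb pb qb"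
    and A2: "param_cont_prox_regular g xb pb vh"
    and A3: "lipschitz_like (\<lambda>p. epi (\<lambda>x. g x p)) pb (xb, real_of_ereal (g xb pb))"
    and mono: "locally_strongly_monotone f xb pb qb \<sigma>"
    and modulus: "\<sigma> > prox_threshold g xb pb vh"
  shows "hoelder_fully_stable (solution_map f g) xb vb pb qb"
proof -
  have "{r. r > 0 \<and> prox_regular_with g xb pb vh r} \<noteq> {}"
    using A2 by (auto simp: param_cont_prox_regular_def)
  then obtain r where r: "r > 0" "prox_regular_with g xb pb vh r" "r < \<sigma>"
    using cInf_lessD[OF _ modulus[unfolded prox_threshold_def]] by blast
  have base: "vh \<in> partial_subdiff g xb pb" using xb_sol by (auto simp: solution_map_def vh)
  have cont: "continuous (at (xb, pb, vh) within gph_partial_subdiff g) (\<lambda>(x, p, v). g x p)"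
    using A2 by (simp add: param_cont_prox_regular_def)
  obtain G l a c where "prox_regular_data g xb vh pb G r l a c"
    using prox_regular_data_exists[OF g_lsc base r(1,2) cont A3] .
  then interpret prox_regular_data g xb vh pb G r l a c .
  obtain L d1 where L: "L > 0" and d1: "d1 > 0"
    and lip: "\<And>x1 x2 p1 p2 q1 q2. \<lbrakk>x1 \<in> ball xb d1; x2 \<in> ball xb d1; p1 \<in> ball pb d1;
      p2 \<in> ball pb d1; q1 \<in> ball qb d1; q2 \<in> ball qb d1\<rbrakk>
      \<Longrightarrow> norm (f x1 p1 q1 - f x2 p2 q2) \<le> L * (norm (x1 - x2) + dist p1 p2 + dist q1 q2)"
    using locally_lipschitz_at_ball[OF A1] by blast
  obtain d2 where d2: "d2 > 0"
    and sm: "\<And>x1 x2 p q. \<lbrakk>x1 \<in> ball xb d2; x2 \<in> ball xb d2; p \<in> ball pb d2; q \<in> ball qb d2\<rbrakk>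
      \<Longrightarrow> \<sigma> * (norm (x1 - x2))\<^sup>2 \<le> (f x1 p q - f x2 p q) \<bullet> (x1 - x2)"
    using locally_strongly_monotone_ball[OF mono] by blast
  show ?thesis
  proof (rule hoelder_fully_stable_if_strongly_monotone[where d = "min d1 d2" and L = "max L \<sigma>"
        and f = f and \<sigma> = \<sigma>, OF vh])
    show "0 < min d1 d2" "0 < max L \<sigma>" "\<sigma> \<le> max L \<sigma>" "r < \<sigma>" using d1 d2 L r by auto
    show "norm (f x1 p1 q1 - f x2 p2 q2) \<le> max L \<sigma> * (norm (x1 - x2) + dist p1 p2 + dist q1 q2)"
      if "x1 \<in> ball xb (min d1 d2)" "x2 \<in> ball xb (min d1 d2)" "p1 \<in> ball pb (min d1 d2)"
        "p2 \<in> ball pb (min d1 d2)" "q1 \<in> ball qb (min d1 d2)" "q2 \<in> ball qb (min d1 d2)"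
      for x1 x2 p1 p2 q1 q2
    proof -
      have "norm (f x1 p1 q1 - f x2 p2 q2) \<le> L * (norm (x1 - x2) + dist p1 p2 + dist q1 q2)"
        using that by (intro lip) auto
      also have "\<dots> \<le> max L \<sigma> * (norm (x1 - x2) + dist p1 p2 + dist q1 q2)"
        by (intro mult_right_mono) auto
      finally show ?thesis .
    qed
    show "\<sigma> * (norm (x1 - x2))\<^sup>2 \<le> (f x1 p q - f x2 p q) \<bullet> (x1 - x2)"
      if "x1 \<in> ball xb (min d1 d2)" "x2 \<in> ball xb (min d1 d2)" "p \<in> ball pb (min d1 d2)"
        "q \<in> ball qb (min d1 d2)" for x1 x2 p q
      using that by (intro sm) auto
  qed
qed

end
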